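(* Let $0<q<1$ and let $\mathcal{K}_{a,c}$ ($a>0$) be the integral operators on $C[-1,1]$ defined in the context. Then: (a) For $a,b>0$, $\mathcal{K}_{b,\,cq^{-a/2}}\,\mathcal{K}_{a,c}=\mathcal{K}_{a+b,c}$. (b) $\mathcal{K}_{a,c}$ tends to the identity operator as $a\to0^+$; that is, for every $f\in C[-1,1]$, $\mathcal{K}_{a,c}f\to f$ uniformly on $[-1,1]$ as $a\to 0^+$. (c) For $a>1$, $\mathcal{D}_q\,\mathcal{K}_{a,c}=\mathcal{K}_{a-1,c}$, where $\mathcal{D}_q$ is the Askey--Wilson divided difference operator.
   Context: Throughout $0<q<1$, $(A;q)_\infty=\prod_{k\ge0}(1-Aq^k)$, $(A_1,\dots,A_m;q)_\infty=\prod_j(A_j;q)_\infty$, and $$h(\cos\theta;a_1,\dots,a_n)=\prod_{j=1}^n(a_je^{i\theta},a_je^{-i\theta};q)_\infty .$$ The normalized continuous $q$-Hermite weight is $$w_H(x|q)=\frac{(q,e^{2i\theta},e^{-2i\theta};q)_\infty}{2\pi\sqrt{1-x^2}},\qquad x=\cos\theta .$$ The parameter $c$ is a nonzero complex number such that $h(\cos\phi;-1/c,-cq)$ has no zeros for $\phi\in[0,\pi]$ (i.e. $|c|\notin\{q^k:k\in\mathbb Z\}$); this is assumed for the second index of every operator appearing. Powers are principal. For $a>0$ and $f\in C[-1,1]$, $$(\mathcal{K}_{a,c}f)(\cos\theta)=q^{a(a-3)/4}\Big(\frac{1-q}{2c}\Big)^a h(\cos\theta;-cq^{1-a/2},-q^{a/2}/c)\int_0^\pi\frac{w_H(\cos\phi|q)\,(q^a;q)_\infty\,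 f(\cos\phi)\sin\phi\,d\phi}{h(\cos\phi;q^{a/2}e^{i\theta},q^{a/2}e^{-i\theta})\,h(\cos\phi;-1/c,-cq)} .$$ Askey--Wilson operator: write $x=(z+1/z)/2$ and $\breve f(z)=f(x)$ (using the analytic extension of $\breve f$ off the unit circle); then $$(\mathcal{D}_qf)(x)=\frac{\breve f(q^{1/2}z)-\breve f(q^{-1/2}z)}{(q^{1/2}-q^{-1/2})(z-1/z)/2}.$$ For $a>1$, $\mathcal{K}_{a,c}f$ is extended by replacing $e^{i\theta}$ with $z$ in the defining formula. *)

theory Defs
  imports "HOL-Analysis.Analysis"
begin

text \<open>The infinite \<open>q\<close>-shifted factorial \<open>(A;q)\<^sub>\<infinity>\<close>.\<close>

definition qpoch_inf :: "real \<Rightarrow> complex \<Rightarrow> complex" where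
  "qpoch_inf q A = (\<Prod>k. 1 - A * of_real q ^ k)"

text \<open>
  \<open>h_prod q z [a\<^sub>1, \<dots>, a\<^sub>n]\<close> is \<open>h(x; a\<^sub>1, \<dots>, a\<^sub>n)\<close> written in the variable \<open>z\<close> with
  \<open>x = (z + 1/z)/2\<close>; thus \<open>h(cos \<theta>; \<dots>)\<close> is the case \<open>z = cis \<theta>\<close>.
\<close>

definition h_prod :: "real \<Rightarrow> complex \<Rightarrow> complex list \<Rightarrow> complex" where
  "h_prod q z as = (\<Prod>a\<leftarrow>as. qpoch_inf q (a * z) * qpoch_inf q (a / z))"

definition w_H :: "real \<Rightarrow> real \<Rightarrow> complex" where
  "w_H q x = (let \<theta> = arccos x in
     qpoch_inf q (of_real q) * qpoch_inf q (cis (2 * \<theta>)) * qpoch_inf q (cis (- 2 * \<theta>))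
       / of_real (2 * pi * sqrt (1 - x\<^sup>2)))"

definition admissible :: "real \<Rightarrow> complex \<Rightarrow> bool" where
  "admissible q c \<longleftrightarrow>
     c \<noteq> 0 \<and> (\<forall>\<phi>\<in>{0..pi}. h_prod q (cis \<phi>) [- 1 / c, - c * of_real q] \<noteq> 0)"

text \<open>
  The defining formula of \<open>\<K>\<^sub>a\<^sub>,\<^sub>c f\<close> with \<open>e\<^sup>i\<^sup>\<theta>\<close> replaced by \<open>z\<close>.
\<close>

definition K_ext :: "real \<Rightarrow> real \<Rightarrow> complex \<Rightarrow> (real \<Rightarrow> complex) \<Rightarrow> complex \<Rightarrow> complex" where
  "K_ext q a c f z =
     of_real (q powr (a * (a - 3) / 4)) * (of_real (1 - q) / (2 * c)) powr of_real a
     * h_prod q z [- c * of_real (q powr (1 - a / 2)), - of_real (q powr (a / 2)) / c]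
     * integral {0..pi} (\<lambda>\<phi>.
         w_H q (cos \<phi>) * qpoch_inf q (of_real (q powr a)) * f (cos \<phi>) * of_real (sin \<phi>)
         / (h_prod q (cis \<phi>) [of_real (q powr (a / 2)) * z, of_real (q powr (a / 2)) / z]
            * h_prod q (cis \<phi>) [- 1 / c, - c * of_real q]))"

text \<open>The operator itself; only the values for \<open>x \<in> {-1..1}\<close> are meaningful.\<close>

definition K_op :: "real \<Rightarrow> real \<Rightarrow> complex \<Rightarrow> (real \<Rightarrow> complex) \<Rightarrow> real \<Rightarrow> complex" where
  "K_op q a c f x = K_ext q a c f (cis (arccos x))"

text \<open>
  \<open>F\<close> is an analytic extension of \<open>e\<^sup>i\<^sup>\<theta> \<mapsto> f(cos \<theta>)\<close> to an open annulus containing the closed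
  annulus \<open>q\<^sup>1\<^sup>/\<^sup>2 \<le> |z| \<le> q\<^sup>-\<^sup>1\<^sup>/\<^sup>2\<close>. By the identity theorem any two such extensions agree on that
  closed annulus, so the choice in \<open>breve\<close> below is immaterial.
\<close>

definition is_breve :: "real \<Rightarrow> (real \<Rightarrow> complex) \<Rightarrow> (complex \<Rightarrow> complex) \<Rightarrow> bool" where
  "is_breve q f F \<longleftrightarrow>
     (\<exists>r. 0 < r \<and> r < sqrt q \<and> F holomorphic_on {z. r < cmod z \<and> cmod z < 1 / r}) \<and>
     (\<forall>\<theta>. F (cis \<theta>) = f (cos \<theta>))"

definition breve :: "real \<Rightarrow> (real \<Rightarrow> complex) \<Rightarrow> complex \<Rightarrow> complex" where
  "breve q f = (SOME F. is_breve q f F)"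

definition AW_quotient :: "real \<Rightarrow> (complex \<Rightarrow> complex) \<Rightarrow> complex \<Rightarrow> complex" where
  "AW_quotient q F z =
     (F (of_real (sqrt q) * z) - F (z / of_real (sqrt q)))
     / (of_real (sqrt q - 1 / sqrt q) * (z - 1 / z) / 2)"

text \<open>
  The Askey--Wilson operator on \<open>{-1..1}\<close>. At \<open>x = \<plusminus>1\<close> (\<open>z = \<plusminus>1\<close>) the quotient is \<open>0/0\<close>; the value
  there is the limit from inside the interval.
\<close>

definition AW_op :: "real \<Rightarrow> (real \<Rightarrow> complex) \<Rightarrow> real \<Rightarrow> complex" where
  "AW_op q f x =
     (if x \<in> {-1<..<1} then AW_quotient q (breve q f) (cis (arccos x))
      else Lim (at x within {-1<..<1}) (\<lambda>y. AW_quotient q (breve q f) (cis (arccos y))))"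

end

theory Submission
  imports Defs "HOL-Complex_Analysis.Complex_Analysis"
begin

text \<open>
  With \<open>r = q\<^sup>a\<^sup>/\<^sup>2\<close>, the operator \<open>\<K>\<^sub>a\<^sub>,\<^sub>c\<close> is, up to a constant, the Poisson operator \<open>P\<^sub>r\<close> of the continuous
  \<open>q\<close>-Hermite polynomials conjugated by multiplication with \<open>h(\<cdot>; -1/c, -cq)\<close>; the index shift in (a)
  makes the multipliers cancel. So (a) is \<open>P\<^sub>t P\<^sub>r = P\<^sub>r\<^sub>t\<close>, which is Fubini together with the
  Askey--Wilson integral. That integral is obtained from a \<open>q\<close>-difference equation in one parameter:
  shifting the circle of integration between \<open>|z| = q\<^sup>1\<^sup>/\<^sup>2\<close> and \<open>|z| = q\<^sup>-\<^sup>1\<^sup>/\<^sup>2\<close> yields a linear relation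
  between the moments of order 0 and 1 of the weight, hence \<open>I(q t\<^sub>1, \<dots>)\<close> is an explicit multiple of
  \<open>I(t\<^sub>1, \<dots>)\<close>; iteration sends the parameters to 0. The constant \<open>I(0,0,0,0)\<close> comes from the
  parameters \<open>q, -q, q\<^sup>1\<^sup>/\<^sup>2, -q\<^sup>1\<^sup>/\<^sup>2\<close>, for which the integrand is a multiple of \<open>sin\<^sup>2 \<phi>\<close>.
  For (b), the Poisson kernel is nonnegative of mass 1 and is \<open>O((1 - r\<^sup>2) / (x - y)\<^sup>2)\<close> off the diagonal.
  Part (c) is an identity between the kernels.
\<close>

section \<open>Auxiliary facts from analysis\<close>

text \<open>The average over a circle is, up to the factor \<open>\<i>\<close>, the contour integral
  of \<open>F z / z\<close>. Concentric circles are homotopic loops in the annulus, which excludes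
  0, so Cauchy's theorem applies.\<close>

lemma circle_average_shift:
  assumes F: "F holomorphic_on {z. R1 < norm z \<and> norm z < R2}" and "0 \<le> R1"
    and r: "R1 < r1" "r1 < R2" "R1 < r2" "r2 < R2"
  shows "integral {-pi..pi} (\<lambda>\<phi>. F (of_real r1 * cis \<phi>)) = integral {-pi..pi} (\<lambda>\<phi>. F (of_real r2 * cis \<phi>))"
proof -
  define S where "S = {z::complex. R1 < norm z \<and> norm z < R2}"
  have eq: "contour_integral (part_circlepath 0 r (-pi) pi) (\<lambda>z. F z / z)
          = \<i> * integral {-pi..pi} (\<lambda>\<phi>. F (of_real r * cis \<phi>))" if "r > 0" for r
  proof -
    have "contour_integral (part_circlepath 0 r (-pi) pi) (\<lambda>z. F z / z)
        = integral {-pi..pi} (\<lambda>t. F (0 + r * cis t) / (0 + r * cis t) * r * \<i> * cis t)"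
      by (rule contour_integral_part_circlepath_eq) auto
    also have "\<dots> = integral {-pi..pi} (\<lambda>t. \<i> * F (r * cis t))"
      using that by (intro integral_cong) (simp add: field_simps)
    finally show ?thesis by simp
  qed
  have "contour_integral (part_circlepath 0 r1 (-pi) pi) (\<lambda>z. F z / z)
      = contour_integral (part_circlepath 0 r2 (-pi) pi) (\<lambda>z. F z / z)"
  proof (rule Cauchy_theorem_homotopic_loops)
    have "open {z::complex. R1 < norm z}" "open {z::complex. norm z < R2}"
      by (intro open_Collect_less continuous_intros)+
    thus "open S"
      unfolding S_def using open_Int by (auto simp: Collect_conj_eq)
    show "(\<lambda>z. F z / z) holomorphic_on S"
      using \<open>0 \<le> R1\<close> F unfolding S_def by (auto intro!: holomorphic_intros)
    \<comment> \<open>At equal parameter the two points lie on one ray from 0, so the segment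
      joining them is radial and stays in the annulus.\<close>
    show "homotopic_loops S (part_circlepath 0 r1 (-pi) pi) (part_circlepath 0 r2 (-pi) pi)"
    proof (rule homotopic_loops_linear)
      fix t :: real
      define e where "e = cis (linepath (-pi) pi t)"
      have *: "part_circlepath 0 r (-pi) pi t = of_real r * e" for r
        by (simp add: part_circlepath_def e_def cis_conv_exp)
      have "closed_segment r1 r2 \<subseteq> {R1<..<R2}"
        using r by (intro closed_segment_subset) auto
      hence "of_real x * e \<in> S" if "x \<in> closed_segment r1 r2" for x
        using that \<open>0 \<le> R1\<close> by (auto simp: S_def e_def norm_mult dest!: subsetD)
      moreover have "closed_segment (of_real r1 * e) (of_real r2 * e) = (\<lambda>x. of_real x * e) ` closed_segment r1 r2"
        using closed_segment_linear_image[of "\<lambda>x. of_real x * e" r1 r2]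
        by (auto intro: bounded_linear.linear bounded_linear_mult_const bounded_linear_of_real)
      ultimately show "closed_segment (part_circlepath 0 r1 (-pi) pi t) (part_circlepath 0 r2 (-pi) pi t) \<subseteq> S"
        unfolding * by auto
    qed (auto simp: exp_minus)
  qed auto
  thus ?thesis
    using eq[of r1] eq[of r2] r \<open>0 \<le> R1\<close> by simp
qed

lemma integral_symmetric_even:
  fixes f :: "real \<Rightarrow> complex"
  assumes "continuous_on {-a..a} f" and even: "\<And>x. f (-x) = f x" and "a \<ge> 0"
  shows "integral {-a..a} f = 2 * integral {0..a} f"
proof -
  have "integral {-a..a} f = integral {-a..0} f + integral {0..a} f"
    using assms(1,3)
    by (intro Henstock_Kurzweil_Integration.integral_combine[symmetric] integrable_continuous_interval) auto
  moreover have "integral {-a..-0} (\<lambda>x. f (-x)) = integral {0..a} f"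
    using Henstock_Kurzweil_Integration.integral_reflect_real[of a 0 f] by simp
  ultimately show ?thesis using even by simp
qed

text \<open>Heine-Cantor on the compact product. It will control the factor in front of the Poisson
  integral as the order tends to 0.\<close>

lemma uniform_limit_at_right_compact:
  fixes E :: "real \<times> 'a :: metric_space \<Rightarrow> 'b :: metric_space"
  assumes E: "continuous_on ({0..1} \<times> X) E" and X: "compact X"
  shows "uniform_limit X (\<lambda>a x. E (a, x)) (\<lambda>x. E (0, x)) (at_right 0)"
proof (rule uniform_limitI)
  fix e :: real assume "e > 0"
  have "uniformly_continuous_on ({0..1} \<times> X) E"
    using E X by (intro compact_uniformly_continuous compact_Times) auto
  then obtain d where d: "d > 0"
    "\<And>p p'. p \<in> {0..1} \<times> X \<Longrightarrow> p' \<in> {0..1} \<times> X \<Longrightarrow> dist p' p < d \<Longrightarrow> dist (E p') (E p) < e"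
    using \<open>e > 0\<close> unfolding uniformly_continuous_on_def by meson
  have "\<forall>\<^sub>F a in at_right 0. a \<in> {0<..<min d 1}"
    using d(1) by (intro eventually_at_right_real) auto
  thus "\<forall>\<^sub>F a in at_right 0. \<forall>x\<in>X. dist (E (a, x)) (E (0, x)) < e"
  proof eventually_elim
    case (elim a)
    thus ?case using d(2) by (auto simp: dist_Pair_Pair)
  qed
qed

lemma open_annulus: "open {z::complex. r < norm z \<and> norm z < R}"
proof -
  have "open {z::complex. r < norm z}" "open {z::complex. norm z < R}"
    by (intro open_Collect_less continuous_intros)+
  thus ?thesis using open_Int by (auto simp: Collect_conj_eq)
qed

text \<open>Both extensions are holomorphic on the smaller of their two annuli and agree on the unit
  circle, so the identity theorem applies. This removes the choice made in
  \<open>breve\<close>.\<close>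

lemma is_breve_unique:
  assumes F: "is_breve q f F" and G: "is_breve q f G" and q: "0 < q" "q < 1"
    and z: "sqrt q \<le> norm z" "norm z \<le> 1 / sqrt q"
  shows "F z = G z"
proof -
  obtain r1 where r1: "0 < r1" "r1 < sqrt q" "F holomorphic_on {z. r1 < cmod z \<and> cmod z < 1 / r1}"
    using F by (auto simp: is_breve_def)
  obtain r2 where r2: "0 < r2" "r2 < sqrt q" "G holomorphic_on {z. r2 < cmod z \<and> cmod z < 1 / r2}"
    using G by (auto simp: is_breve_def)
  define r where "r = max r1 r2"
  define A where "A = {z::complex. r < norm z \<and> norm z < 1 / r}"
  have r: "0 < r" "r < sqrt q" "r1 \<le> r" "r2 \<le> r" using r1 r2 by (auto simp: r_def)
  have rr: "1 / r \<le> 1 / r1" "1 / r \<le> 1 / r2" "1 / sqrt q < 1 / r" "r < 1" "1 < 1 / r"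
    using r r1 r2 q by (auto simp: field_simps) (metis less_trans real_sqrt_lt_1_iff)+
  have hol: "F holomorphic_on A" "G holomorphic_on A"
    by (rule holomorphic_on_subset[OF r1(3)]; use r rr in \<open>force simp: A_def\<close>)
       (rule holomorphic_on_subset[OF r2(3)]; use r rr in \<open>force simp: A_def\<close>)
  have "F z - G z = 0"
  proof (rule analytic_continuation[of "\<lambda>z. F z - G z" A "sphere 0 1" 1 z])
    show "(\<lambda>z. F z - G z) holomorphic_on A" by (intro holomorphic_intros hol)
    show "open A" unfolding A_def by (rule open_annulus)
    show "connected A" unfolding A_def using connected_annulus(1)[of r "0::complex" "1 / r"] by simp
    show "sphere 0 1 \<subseteq> A" using rr by (auto simp: A_def)
    show "1 \<in> A" using rr by (auto simp: A_def)
    \<comment> \<open>A connected set with more than one point has no isolated points; hence the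
      circle accumulates at 1.\<close>
    have "(1::complex) \<in> sphere 0 1" "(-1::complex) \<in> sphere 0 1" "(1::complex) \<noteq> -1" by auto
    hence "\<nexists>a. sphere (0::complex) 1 = {a}" by (metis singletonD)
    thus "(1::complex) islimpt sphere 0 1"
      by (intro connected_imp_perfect connected_sphere) auto
    show "z \<in> A" using z r rr by (auto simp: A_def)
    show "F x - G x = 0" if "x \<in> sphere 0 1" for x
    proof -
      have "x = cis (Arg x)"
        using that cis_Arg[of x] by (cases "x = 0") (auto simp: sgn_div_norm)
      thus ?thesis using F G unfolding is_breve_def by (metis diff_self)
    qed
  qed
  thus ?thesis by simp
qed

section \<open>The infinite \<open>q\<close>-shifted factorial\<close>

locale q_base =
  fixes q :: real
  assumes q_pos: "0 < q" and q_less_1: "q < 1"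
begin

abbreviation qp :: "complex \<Rightarrow> complex" where "qp \<equiv> qpoch_inf q"

lemma abs_convergent_qp: "abs_convergent_prod (\<lambda>k. 1 - A * of_real q ^ k :: complex)"
proof -
  have "summable (\<lambda>k. norm A * q ^ k)"
    using q_pos q_less_1 by (intro summable_mult summable_geometric) auto
  thus ?thesis
    using q_pos by (simp add: abs_convergent_prod_conv_summable norm_mult norm_power)
qed

lemma convergent_qp: "convergent_prod (\<lambda>k. 1 - A * of_real q ^ k :: complex)"
  using abs_convergent_qp by (rule abs_convergent_prod_imp_convergent_prod)

lemma qp_LIMSEQ: "(\<lambda>n. \<Prod>k<n. 1 - A * of_real q ^ k) \<longlonglongrightarrow> qp A"
  using convergent_prod_LIMSEQ[OF convergent_qp]
  unfolding qpoch_inf_def LIMSEQ_lessThan_iff_atMost .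

lemma qp_0 [simp]: "qp 0 = 1"
  by (simp add: qpoch_inf_def)

lemma qp_rec: "qp A = (1 - A) * qp (of_real q * A)"
proof (rule LIMSEQ_unique)
  show "(\<lambda>n. \<Prod>k<Suc n. 1 - A * of_real q ^ k) \<longlonglongrightarrow> qp A"
    by (rule LIMSEQ_Suc[OF qp_LIMSEQ])
  have "(\<Prod>k<Suc n. 1 - A * of_real q ^ k) = (1 - A) * (\<Prod>k<n. 1 - of_real q * A * of_real q ^ k)" for n
    by (subst prod.lessThan_Suc_shift) (simp add: mult_ac)
  thus "(\<lambda>n. \<Prod>k<Suc n. 1 - A * of_real q ^ k) \<longlonglongrightarrow> (1 - A) * qp (of_real q * A)"
    by (simp only:) (intro tendsto_intros qp_LIMSEQ)
qed

lemma qp_nonzero: 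
  assumes "norm A < 1"
  shows   "qp A \<noteq> 0"
  unfolding qpoch_inf_def
proof (rule prodinf_nonzero[OF convergent_qp])
  fix k
  have "norm (A * of_real q ^ k) \<le> norm A * 1"
    unfolding norm_mult using q_pos q_less_1
    by (intro mult_left_mono) (auto simp: norm_power power_le_one)
  with assms have "norm (A * of_real q ^ k) < 1" by simp
  thus "1 - A * of_real q ^ k \<noteq> 0" by auto
qed

lemma qp_cnj: "qp (cnj A) = cnj (qp A)"
proof (rule LIMSEQ_unique[OF qp_LIMSEQ])
  have "(\<lambda>n. cnj (\<Prod>k<n. 1 - A * of_real q ^ k)) \<longlonglongrightarrow> cnj (qp A)"
    by (intro tendsto_intros qp_LIMSEQ)
  thus "(\<lambda>n. \<Prod>k<n. 1 - cnj A * of_real q ^ k) \<longlonglongrightarrow> cnj (qp A)"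
    by simp
qed

text \<open>The partial products converge uniformly on each closed disc of radius 1, by comparison
  with the geometric series \<open>(norm x + 1) * q ^ k\<close>, so the limit is entire.\<close>

lemma qp_holomorphic_UNIV: "qp holomorphic_on UNIV"
proof (rule holomorphic_uniform_sequence)
  show "(\<lambda>A. \<Prod>k<n. 1 - A * of_real q ^ k) holomorphic_on UNIV" for n
    by (intro holomorphic_intros)
  show "\<exists>d>0. cball x d \<subseteq> UNIV \<and>
      uniform_limit (cball x d) (\<lambda>n A. \<Prod>k<n. 1 - A * of_real q ^ k) qp sequentially" for x
  proof (intro exI[of _ 1] conjI)
    have "uniformly_convergent_on (cball x 1) (\<lambda>N A. \<Prod>k<N. 1 - A * of_real q ^ k)"
    proof (rule uniformly_convergent_on_prod')
      show "uniformly_convergent_on (cball x 1) (\<lambda>N A. \<Sum>k<N. norm (1 - A * of_real q ^ k - 1))"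
      proof (rule Weierstrass_m_test'_ev[of _ _ "\<lambda>k. (norm x + 1) * q ^ k"])
        show "\<forall>\<^sub>F n in sequentially. \<forall>y\<in>cball x 1.
                 norm (norm (1 - y * complex_of_real q ^ n - 1)) \<le> (norm x + 1) * q ^ n"
        proof (intro always_eventually allI ballI)
          fix n y assume "y \<in> cball x 1"
          hence "norm y \<le> norm x + 1"
            using norm_triangle_sub[of y x] by (auto simp: dist_norm norm_minus_commute)
          thus "norm (norm (1 - y * complex_of_real q ^ n - 1)) \<le> (norm x + 1) * q ^ n"
            using q_pos by (auto simp: norm_mult norm_power intro: mult_right_mono)
        qed
        show "summable (\<lambda>k. (norm x + 1) * q ^ k)"
          using q_pos q_less_1 by (intro summable_mult summable_geometric) auto
      qed
    qed (auto intro!: continuous_intros)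
    then obtain g where g: "uniform_limit (cball x 1) (\<lambda>N A. \<Prod>k<N. 1 - A * of_real q ^ k) g sequentially"
      unfolding uniformly_convergent_on_def by blast
    have "g y = qp y" if "y \<in> cball x 1" for y
      using tendsto_uniform_limitI[OF g that] qp_LIMSEQ LIMSEQ_unique by blast
    thus "uniform_limit (cball x 1) (\<lambda>N A. \<Prod>k<N. 1 - A * of_real q ^ k) qp sequentially"
      using g by (subst uniform_limit_cong'[where i = g]) auto
  qed auto
qed auto

lemma qp_holomorphic [holomorphic_intros]:
  "f holomorphic_on S \<Longrightarrow> (\<lambda>x. qp (f x)) holomorphic_on S"
  using holomorphic_on_compose_gen[OF _ qp_holomorphic_UNIV] by (auto simp: o_def)

lemma qp_continuous [continuous_intros]:
  "continuous_on S f \<Longrightarrow> continuous_on S (\<lambda>x. qp (f x))"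
  using continuous_on_compose2[OF holomorphic_on_imp_continuous_on[OF qp_holomorphic_UNIV]] by blast

lemma sqrt_q: "sqrt q > 0" "sqrt q < 1" "of_real (sqrt q) * of_real (sqrt q) = (of_real q :: complex)"
  using q_pos q_less_1 by (auto simp flip: of_real_mult)

text \<open>Every factor is a difference of two squares: the even indices yield the factors of
  \<open>qp z * qp (- z)\<close>, the odd ones those with an extra square root of q. Hence partial
  products of length 2n are compared with four of length n.\<close>

lemma qp_dup: "qp (z\<^sup>2) = qp z * qp (- z) * qp (of_real (sqrt q) * z) * qp (- (of_real (sqrt q) * z))"
proof (rule LIMSEQ_unique)
  have "strict_mono (\<lambda>n::nat. 2 * n)" by (auto intro: strict_monoI)
  from LIMSEQ_subseq_LIMSEQ[OF qp_LIMSEQ this]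
  show "(\<lambda>n. \<Prod>k<2*n. 1 - z\<^sup>2 * of_real q ^ k) \<longlonglongrightarrow> qp (z\<^sup>2)"
    by (simp add: o_def)
  define s :: complex where "s = of_real (sqrt q)"
  have s: "s * s = of_real q" using sqrt_q by (simp add: s_def)
  have *: "(1 - z\<^sup>2 * of_real q ^ (2*n)) = (1 - z * of_real q ^ n) * (1 - (-z) * of_real q ^ n)"
          "(1 - z\<^sup>2 * of_real q ^ (2*n+1)) = (1 - s * z * of_real q ^ n) * (1 - -(s * z) * of_real q ^ n)" for n
    by (simp_all add: algebra_simps power2_eq_square power_add power_mult flip: s)
  have "(\<Prod>k<2*n. 1 - z\<^sup>2 * of_real q ^ k) = (\<Prod>k<n. 1 - z * of_real q ^ k) * (\<Prod>k<n. 1 - (-z) * of_real q ^ k) *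
     (\<Prod>k<n. 1 - (s * z) * of_real q ^ k) * (\<Prod>k<n. 1 - (-(s * z)) * of_real q ^ k)" for n
  proof (induction n)
    case (Suc n)
    have "(\<Prod>k<2*Suc n. 1 - z\<^sup>2 * of_real q ^ k) = 
        (\<Prod>k<2*n. 1 - z\<^sup>2 * of_real q ^ k) * (1 - z\<^sup>2 * of_real q ^ (2*n)) * (1 - z\<^sup>2 * of_real q ^ (2*n+1))"
      by simp
    thus ?case by (simp only: Suc.IH * prod.lessThan_Suc) (simp only: mult_ac)
  qed simp
  thus "(\<lambda>n. \<Prod>k<2*n. 1 - z\<^sup>2 * of_real q ^ k) \<longlonglongrightarrow> qp z * qp (- z) * qp (of_real (sqrt q) * z) * qp (- (of_real (sqrt q) * z))"
    by (simp only:) (intro tendsto_intros qp_LIMSEQ[of z] qp_LIMSEQ[of "-z"] qp_LIMSEQ[of "s*z", unfolded s_def] qp_LIMSEQ[of "-(s*z)", unfolded s_def] | simp only: s_def)+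
qed

section \<open>The Askey--Wilson integral\<close>

abbreviation s :: complex where "s \<equiv> of_real (sqrt q)"

definition hh :: "complex \<Rightarrow> complex \<Rightarrow> complex" where
  "hh t z = qp (t * z) * qp (t / z)"

text \<open>The q-Hermite weight times sin \<phi>, with the square root already cancelled. In this
  form it is continuous and even on the whole real line.\<close>

definition wt :: "real \<Rightarrow> complex" where
  "wt \<phi> = qp (of_real q) * qp (cis \<phi> ^ 2) * qp (1 / cis \<phi> ^ 2) / of_real (2 * pi)"

definition AW :: "complex \<Rightarrow> complex \<Rightarrow> complex \<Rightarrow> complex \<Rightarrow> complex" where
  "AW t1 t2 t3 t4 = integral {0..pi}
     (\<lambda>\<phi>. wt \<phi> / (hh t1 (cis \<phi>) * hh t2 (cis \<phi>) * hh t3 (cis \<phi>) * hh t4 (cis \<phi>)))"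

lemma hh_nonzero: "norm (t * z) < 1 \<Longrightarrow> norm (t / z) < 1 \<Longrightarrow> hh t z \<noteq> 0"
  by (auto simp: hh_def qp_nonzero)

lemma hh_cis_nonzero [simp]: "norm t < 1 \<Longrightarrow> hh t (cis \<phi>) \<noteq> 0"
  by (rule hh_nonzero) (simp_all add: norm_mult norm_divide)

lemma hh_0 [simp]: "hh 0 z = 1"
  by (simp add: hh_def)

lemma hh_inverse: "hh t (1 / z) = hh t z"
  by (simp add: hh_def mult.commute)

lemma cis_minus: "cis (-x) = 1 / cis x"
  by (simp add: field_simps cis_mult)

lemma hh_continuous [continuous_intros]:
  "continuous_on S f \<Longrightarrow> continuous_on S g \<Longrightarrow> (\<And>x. x \<in> S \<Longrightarrow> g x \<noteq> 0) \<Longrightarrow> continuous_on S (\<lambda>x. hh (f x) (g x))"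
  unfolding hh_def by (intro continuous_intros) auto

lemma hh_holomorphic [holomorphic_intros]:
  "f holomorphic_on S \<Longrightarrow> g holomorphic_on S \<Longrightarrow> (\<And>x. x \<in> S \<Longrightarrow> g x \<noteq> 0) \<Longrightarrow> (\<lambda>x. hh (f x) (g x)) holomorphic_on S"
  unfolding hh_def by (intro holomorphic_intros) auto

lemma wt_continuous [continuous_intros]: "continuous_on S f \<Longrightarrow> continuous_on S (\<lambda>x. wt (f x))"
  unfolding wt_def by (intro continuous_intros) auto

lemma wt_minus: "wt (-x) = wt x"
  by (simp add: wt_def cis_minus power_divide)

lemma hh_minus: "hh t (cis (-x)) = hh t (cis x)"
  by (simp add: cis_minus hh_inverse)

lemma hh_q: "(1 - t * z) * (1 - t / z) * hh (of_real q * t) z = hh t z"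
  using qp_rec[of "t * z"] qp_rec[of "t / z"] by (simp add: hh_def mult_ac)

text \<open>
  The function \<open>G\<close> in the proof satisfies \<open>G(1/w) = -G(w)\<close> and is chosen such that
  \<open>G(q\<^sup>1\<^sup>/\<^sup>2 z) - G(q\<^sup>-\<^sup>1\<^sup>/\<^sup>2 z)\<close> is a multiple of the integrand.
\<close>

lemma AW_moment:
  assumes t: "norm t1 < 1" "norm t2 < 1" "norm t3 < 1" "norm t4 < 1"
  defines "e1 \<equiv> t1 + t2 + t3 + t4"
    and "e3 \<equiv> t1 * t2 * t3 + t1 * t2 * t4 + t1 * t3 * t4 + t2 * t3 * t4"
    and "e4 \<equiv> t1 * t2 * t3 * t4"
  shows "integral {0..pi} (\<lambda>\<phi>. wt \<phi> / (hh t1 (cis \<phi>) * hh t2 (cis \<phi>) * hh t3 (cis \<phi>) * hh t4 (cis \<phi>))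
           * ((e1 - e3) - (1 - e4) * (cis \<phi> + 1 / cis \<phi>))) = 0"
proof -
  define G where "G = (\<lambda>z. (z - 1 / z) * qp (of_real q * z\<^sup>2) * qp (of_real q / z\<^sup>2) /
     (hh (s * t1) z * hh (s * t2) z * hh (s * t3) z * hh (s * t4) z))"
  define N where "N = (\<lambda>\<phi>. wt \<phi> / (hh t1 (cis \<phi>) * hh t2 (cis \<phi>) * hh t3 (cis \<phi>) * hh t4 (cis \<phi>))
           * ((e1 - e3) - (1 - e4) * (cis \<phi> + 1 / cis \<phi>)))"
  have s0: "s \<noteq> 0" and ss: "s * s = of_real q" using sqrt_q by auto
  have qq0: "qp (of_real q) \<noteq> 0" using q_pos q_less_1 by (intro qp_nonzero) auto
  \<comment> \<open>With \<open>T\<close> strictly between the largest modulus and 1, both circles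
    of radius \<open>sqrt q\<close> and \<open>1 / sqrt q\<close> lie inside an open annulus on
    which the denominator of \<open>G\<close> has no zero.\<close>
  obtain T where T: "max (max (norm t1) (norm t2)) (max (norm t3) (norm t4)) < T" "T < 1"
    using dense[of "max (max (norm t1) (norm t2)) (max (norm t3) (norm t4))" 1] t by auto
  hence T0: "T > 0" by (smt (verit) norm_ge_zero)
  \<comment> \<open>On the inner circle the denominator \<open>hh (s * t) (s * z)\<close> is
    \<open>qp (q * t * z) * qp (t / z)\<close>, which is \<open>hh t z\<close> without the factor
    \<open>1 - t * z\<close>; each parameter thus contributes one linear factor to the
    numerator.\<close>
  have half: "G (s * z) = - (qp (of_real q * z\<^sup>2) * qp (of_real q / z\<^sup>2) / (hh t1 z * hh t2 z * hh t3 z * hh t4 z))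
      * ((1 - 1 / z\<^sup>2) / z * ((1 - t1 * z) * (1 - t2 * z) * (1 - t3 * z) * (1 - t4 * z))) / s" 
    if z: "norm z = 1" for z
  proof -
    have z0: "z \<noteq> 0" using z by auto
    have h: "hh (s * t) (s * z) = hh t z / (1 - t * z)" if "norm t < 1" for t
    proof -
      have "norm (t * z) < 1" using that z by (simp add: norm_mult)
      hence "1 - t * z \<noteq> 0" by auto
      moreover have "s * t * (s * z) = of_real q * (t * z)" by (simp add: ss[symmetric])
      moreover have "s * t / (s * z) = t / z" using s0 by simp
      ultimately show ?thesis 
        unfolding hh_def by (simp only: qp_rec[of "t * z"]) simp
    qed
    have a: "(s * z)\<^sup>2 = of_real q * z\<^sup>2"
      by (simp add: power2_eq_square ss[symmetric])
    have b: "(s * z - 1 / (s * z)) = - (1 - of_real q * z\<^sup>2) / (s * z)"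
      using s0 z0 by (simp add: field_simps power2_eq_square ss[symmetric])
    have c: "of_real q / (s * z)\<^sup>2 = 1 / z\<^sup>2"
      using q_pos by (simp add: a)
    have "(s * z - 1 / (s * z)) * qp (of_real q * (s*z)\<^sup>2) * qp (of_real q / (s*z)\<^sup>2)
         = - (qp (of_real q * z\<^sup>2) * ((1 - 1 / z\<^sup>2) * qp (of_real q / z\<^sup>2))) / (s * z)"
    proof -
      have r: "(1 - of_real q * z\<^sup>2) * qp (of_real q * (of_real q * z\<^sup>2)) = qp (of_real q * z\<^sup>2)"
              "(1 - 1 / z\<^sup>2) * qp (of_real q / z\<^sup>2) = qp (1 / z\<^sup>2)"
        using qp_rec[of "of_real q * z\<^sup>2"] qp_rec[of "1 / z\<^sup>2"] by simp_all
      show ?thesis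
        unfolding b c unfolding a by (simp only: times_divide_eq_left mult_minus_left r)
    qed
    thus ?thesis
      unfolding G_def h[OF t(1)] h[OF t(2)] h[OF t(3)] h[OF t(4)] by (simp add: mult_ac)
  qed
  have G_inv: "G (1 / w) = - G w" for w
  proof -
    have a: "1 / w - 1 / (1 / w) = - (w - 1 / w)" by simp
    have b: "of_real q * (1 / w)\<^sup>2 = of_real q / w\<^sup>2" "of_real q / (1 / w)\<^sup>2 = of_real q * w\<^sup>2"
      by (simp_all add: power_divide)
    show ?thesis unfolding G_def hh_inverse a b by (simp del: minus_diff_eq add: mult_ac)
  qed
  \<comment> \<open>The value on the outer circle is minus the value of \<open>G\<close> at
    \<open>s / z\<close>, so \<open>half\<close> covers both circles.\<close>
  have G_diff: "G (s * cis \<phi>) - G (1 / s * cis \<phi>) = of_real (2 * pi) / (qp (of_real q) * s) * N \<phi>" for \<phi>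
  proof -
    define z where "z = cis \<phi>"
    define u where "u = 1 / z"
    have zu: "z * u = 1" by (simp add: u_def z_def)
    have nz: "norm z = 1" "norm u = 1" by (auto simp: z_def u_def norm_divide)
    define V where "V = qp (of_real q * z\<^sup>2) * qp (of_real q / z\<^sup>2) / (hh t1 z * hh t2 z * hh t3 z * hh t4 z)"
    have "G (1 / s * z) = - G (s * u)"
      using G_inv[of "s * u"] by (simp add: u_def)
    also have "G (s * u) = - V * ((1 - z\<^sup>2) * z * ((1 - t1 * u) * (1 - t2 * u) * (1 - t3 * u) * (1 - t4 * u))) / s"
      unfolding half[OF nz(2)] by (simp add: V_def u_def hh_inverse[unfolded divide_inverse] hh_inverse power_divide mult_ac)
    finally have 1: "G (1 / s * z) = V * ((1 - z\<^sup>2) * z * ((1 - t1 * u) * (1 - t2 * u) * (1 - t3 * u) * (1 - t4 * u))) / s"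
      by simp
    have 2: "G (s * z) = - V * ((1 - u\<^sup>2) * u * ((1 - t1 * z) * (1 - t2 * z) * (1 - t3 * z) * (1 - t4 * z))) / s"
      unfolding half[OF nz(1)] by (simp add: V_def u_def power_divide mult_ac)
    \<comment> \<open>Inserting powers of \<open>a * b = 1\<close> centres the quartic at its middle
      coefficient. In \<open>X\<close> the two versions are subtracted: the middle coefficients
      cancel and a second factor \<open>z - u\<close> splits off.\<close>
    have p: "b\<^sup>2 * ((1 - t1 * a) * (1 - t2 * a) * (1 - t3 * a) * (1 - t4 * a)) =
        b\<^sup>2 - e1 * b + (t1 * t2 + t1 * t3 + t1 * t4 + t2 * t3 + t2 * t4 + t3 * t4) - e3 * a + e4 * a\<^sup>2"
      if ab: "a * b = 1" for a b
    proof -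
      have "b\<^sup>2 * ((1 - t1 * a) * (1 - t2 * a) * (1 - t3 * a) * (1 - t4 * a)) = 
        b\<^sup>2 - e1 * b * (a * b) + (t1 * t2 + t1 * t3 + t1 * t4 + t2 * t3 + t2 * t4 + t3 * t4) * (a * b)\<^sup>2
           - e3 * a * (a * b)\<^sup>2 + e4 * a\<^sup>2 * (a * b)\<^sup>2"
        unfolding e1_def e3_def e4_def by (simp add: algebra_simps power2_eq_square)
      thus ?thesis by (simp add: ab)
    qed
    have X: "(1 - z\<^sup>2) * (1 - u\<^sup>2) * ((e1 - e3) - (1 - e4) * (z + u)) = 
       - ((1 - u\<^sup>2) * u * ((1 - t1 * z) * (1 - t2 * z) * (1 - t3 * z) * (1 - t4 * z)))
       - (1 - z\<^sup>2) * z * ((1 - t1 * u) * (1 - t2 * u) * (1 - t3 * u) * (1 - t4 * u))"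
    proof -
      have a: "(1 - u\<^sup>2) * u = (z - u) * u\<^sup>2" "(1 - z\<^sup>2) * z = - (z - u) * z\<^sup>2" 
              "(1 - z\<^sup>2) * (1 - u\<^sup>2) = - (z - u) * (z - u)"
        using zu by algebra+
      show ?thesis
        unfolding a using p[OF zu] p[of u z] zu by (simp add: mult.assoc mult.commute[of u z]) (simp add: algebra_simps power2_eq_square)
    qed
    have "G (s * z) - G (1 / s * z) = V / s * ((1 - z\<^sup>2) * (1 - u\<^sup>2) * ((e1 - e3) - (1 - e4) * (z + u)))"
      unfolding 1 2 X using s0 by (simp add: field_simps)
    also have "\<dots> = V * ((1 - z\<^sup>2) * (1 - u\<^sup>2)) * ((e1 - e3) - (1 - e4) * (z + u)) / s"
      by simp
    also have "V * ((1 - z\<^sup>2) * (1 - u\<^sup>2)) = of_real (2 * pi) / qp (of_real q) * 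
        (wt \<phi> / (hh t1 z * hh t2 z * hh t3 z * hh t4 z))"
      unfolding V_def wt_def z_def[symmetric] using qp_rec[of "z\<^sup>2"] qp_rec[of "1/z\<^sup>2"] qq0
      by (simp add: u_def power_divide mult_ac)
    finally show ?thesis
      unfolding z_def[symmetric] N_def u_def[symmetric] by (simp add: mult_ac) 
  qed
  have cont: "continuous_on A N" for A
    unfolding N_def using t by (intro continuous_intros) auto
  have "N (-x) = N x" for x
    by (simp add: N_def wt_minus hh_minus) (simp add: cis_minus add.commute)
  hence N2: "integral {-pi..pi} N = 2 * integral {0..pi} N"
    using cont by (intro integral_symmetric_even) auto
  have holG: "G holomorphic_on {z. sqrt q * T < norm z \<and> norm z < 1 / (sqrt q * T)}"
  proof -
    have "hh (s * t) z \<noteq> 0" if "norm t < T" "sqrt q * T < norm z" "norm z < 1 / (sqrt q * T)" for t z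
    proof (rule hh_nonzero)
      have st: "norm (s * t) < sqrt q * T" using that sqrt_q by (simp add: norm_mult)
      hence z: "norm z > 0" using that(2) norm_ge_zero[of "s * t"] by linarith
      have "norm (s * t) * norm z < sqrt q * T * norm z"
        using st z by (rule mult_strict_right_mono)
      also have "\<dots> < 1"
        using that(3) T0 sqrt_q by (simp add: pos_less_divide_eq mult.commute)
      finally show "norm (s * t * z) < 1" by (simp add: norm_mult)
      show "norm (s * t / z) < 1"
        unfolding norm_divide using st z that(2) by (subst divide_less_eq_1_pos) linarith+
    qed
    moreover have "z \<noteq> 0" if "sqrt q * T < norm z" for z :: complex
      using that T0 sqrt_q by (metis mult_pos_pos norm_zero order_less_asym)
    ultimately show ?thesis
      unfolding G_def using T by (intro holomorphic_intros) auto
  qed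
  have r: "sqrt q * T < sqrt q" "sqrt q < 1 / (sqrt q * T)" "sqrt q * T < 1 / sqrt q" "1 / sqrt q < 1 / (sqrt q * T)"
    using T0 T sqrt_q q_pos q_less_1 by (auto simp: field_simps)
       (smt (verit) mult_less_cancel_right1 mult_less_cancel_left1)+
  \<comment> \<open>Since \<open>G\<close> is holomorphic between the two circles, its averages over
    them agree; therefore the multiple of \<open>N\<close> in \<open>G_diff\<close> integrates to
    0.\<close>
  have eq: "integral {-pi..pi} (\<lambda>\<phi>. G (of_real (sqrt q) * cis \<phi>)) = integral {-pi..pi} (\<lambda>\<phi>. G (of_real (1 / sqrt q) * cis \<phi>))"
    using T0 sqrt_q by (intro circle_average_shift[OF holG] r) auto
  have int: "(\<lambda>\<phi>. G (of_real r * cis \<phi>)) integrable_on {-pi..pi}" 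
    if "sqrt q * T < r" "r < 1 / (sqrt q * T)" for r
  proof (intro integrable_continuous_interval continuous_on_compose2[OF holomorphic_on_imp_continuous_on[OF holG]])
    have "r > 0" using that(1) T0 sqrt_q by (smt (verit) mult_pos_pos)
    thus "(\<lambda>\<phi>. of_real r * cis \<phi>) ` {- pi..pi} \<subseteq> {z. sqrt q * T < cmod z \<and> cmod z < 1 / (sqrt q * T)}"
      using that by (auto simp: norm_mult)
  qed (intro continuous_intros)
  have "0 = integral {-pi..pi} (\<lambda>\<phi>. G (s * cis \<phi>) - G (1 / s * cis \<phi>))"
    using integral_diff[OF int[OF r(1,2)] int[OF r(3,4)]] eq by simp
  also have "\<dots> = of_real (2 * pi) / (qp (of_real q) * s) * integral {-pi..pi} N"
    unfolding G_diff by simp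
  finally have "integral {-pi..pi} N = 0"
    using qq0 s0 by simp
  with N2 show ?thesis by (simp add: N_def)
qed

section \<open>The q-difference equation in one parameter and its iteration\<close>

lemma AW_integrand_continuous:
  assumes "norm t1 < 1" "norm t2 < 1" "norm t3 < 1" "norm t4 < 1"
  shows "continuous_on A (\<lambda>\<phi>. wt \<phi> / (hh t1 (cis \<phi>) * hh t2 (cis \<phi>) * hh t3 (cis \<phi>) * hh t4 (cis \<phi>)))"
  using assms by (intro continuous_intros) auto

lemma norm_q_mult: "norm t < 1 \<Longrightarrow> norm (of_real q * t :: complex) < 1"
  using q_pos q_less_1 mult_strict_mono[of q 1 "norm t" 1] by (simp add: norm_mult)

lemma norm_mult_less_1: "norm (a::complex) < 1 \<Longrightarrow> norm (b::complex) < 1 \<Longrightarrow> norm (a * b) < 1"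
  using mult_strict_mono[of "norm a" 1 "norm b" 1] by (simp add: norm_mult)

text \<open>Replacing \<open>t1\<close> by \<open>q * t1\<close> multiplies the integrand by
  \<open>1 + t1\<^sup>2 - t1 * (z + 1 / z)\<close>, so only the moments of order 0 and 1 enter, and
  \<open>AW_moment\<close> eliminates the latter.\<close>

lemma AW_q_shift:
  assumes t: "norm t1 < 1" "norm t2 < 1" "norm t3 < 1" "norm t4 < 1"
  shows "(1 - t1 * t2 * t3 * t4) * AW (of_real q * t1) t2 t3 t4
       = (1 - t1 * t2) * (1 - t1 * t3) * (1 - t1 * t4) * AW t1 t2 t3 t4"
proof -
  define f where "f = (\<lambda>\<phi>. wt \<phi> / (hh t1 (cis \<phi>) * hh t2 (cis \<phi>) * hh t3 (cis \<phi>) * hh t4 (cis \<phi>)))"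
  define C where "C = (1 - t1 * t2) * (1 - t1 * t3) * (1 - t1 * t4)"
  define M where "M = (t1 + t2 + t3 + t4) - (t1 * t2 * t3 + t1 * t2 * t4 + t1 * t3 * t4 + t2 * t3 * t4)"
  have f: "continuous_on A f" for A
    unfolding f_def using t by (intro AW_integrand_continuous)
  \<comment> \<open>This polynomial identity is what makes the remaining coefficient of the zeroth
    moment factor into the product \<open>C\<close>.\<close>
  have CM: "(1 - t1 * t2 * t3 * t4) * (1 + t1\<^sup>2) = C + t1 * M"
    by (simp add: C_def M_def algebra_simps power2_eq_square)
  have eq: "(1 - t1 * t2 * t3 * t4) * (wt \<phi> / (hh (of_real q * t1) (cis \<phi>) * hh t2 (cis \<phi>) * hh t3 (cis \<phi>) * hh t4 (cis \<phi>)))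
      = C * f \<phi> + t1 * (f \<phi> * (M - (1 - t1 * t2 * t3 * t4) * (cis \<phi> + 1 / cis \<phi>)))" for \<phi>
  proof -
    define z where "z = cis \<phi>"
    have z: "z \<noteq> 0" "z * (1 / z) = 1" by (auto simp: z_def)
    have "(1 - t1 * z) * (1 - t1 / z) \<noteq> 0"
      using hh_q[of t1 z] hh_cis_nonzero[OF t(1), of \<phi>] unfolding z_def by auto
    hence "wt \<phi> / (hh (of_real q * t1) z * hh t2 z * hh t3 z * hh t4 z) = 
           (1 - t1 * z) * (1 - t1 / z) * f \<phi>"
      unfolding f_def z_def[symmetric] hh_q[of t1 z, symmetric] using z by auto
    also have "(1 - t1 * z) * (1 - t1 / z) = 1 + t1\<^sup>2 - t1 * (z + 1 / z)"
      using z(1) by (simp add: field_simps power2_eq_square)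
    finally have "wt \<phi> / (hh (of_real q * t1) z * hh t2 z * hh t3 z * hh t4 z) = (1 + t1\<^sup>2 - t1 * (z + 1 / z)) * f \<phi>" (is "?lhs = ?rhs") .
    hence "(1 - t1 * t2 * t3 * t4) * (wt \<phi> / (hh (of_real q * t1) z * hh t2 z * hh t3 z * hh t4 z))
        = ((1 - t1 * t2 * t3 * t4) * (1 + t1\<^sup>2) - t1 * (1 - t1 * t2 * t3 * t4) * (z + 1 / z)) * f \<phi>"
      unfolding \<open>?lhs = ?rhs\<close> by (simp add: algebra_simps)
    also have "\<dots> = C * f \<phi> + t1 * (f \<phi> * (M - (1 - t1 * t2 * t3 * t4) * (z + 1 / z)))"
      unfolding CM by (simp add: algebra_simps)
    finally show ?thesis by (simp add: z_def)
  qed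
  have "(1 - t1 * t2 * t3 * t4) * AW (of_real q * t1) t2 t3 t4 = 
        integral {0..pi} (\<lambda>\<phi>. C * f \<phi> + t1 * (f \<phi> * (M - (1 - t1 * t2 * t3 * t4) * (cis \<phi> + 1 / cis \<phi>))))"
    unfolding AW_def integral_mult_right[symmetric] eq ..
  also have "\<dots> = C * integral {0..pi} f + t1 * integral {0..pi} (\<lambda>\<phi>. f \<phi> * (M - (1 - t1 * t2 * t3 * t4) * (cis \<phi> + 1 / cis \<phi>)))"
    by (subst integral_add) (auto intro!: integrable_continuous_interval continuous_intros f)
  also have "integral {0..pi} (\<lambda>\<phi>. f \<phi> * (M - (1 - t1 * t2 * t3 * t4) * (cis \<phi> + 1 / cis \<phi>))) = 0"
    using AW_moment[OF t] unfolding f_def M_def .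
  finally show ?thesis by (simp add: C_def AW_def f_def)
qed

lemma AW_continuous:
  assumes t: "norm t2 < 1" "norm t3 < 1" "norm t4 < 1"
  shows "continuous_on (ball 0 1) (\<lambda>t1. AW t1 t2 t3 t4)"
  unfolding AW_def cbox_interval[symmetric]
  by (rule integral_continuous_on_param)
     (use t in \<open>auto simp: case_prod_unfold intro!: continuous_intros\<close>)

text \<open>The quotient \<open>F\<close> of the integral by its expected dependence on
  \<open>t\<close> is invariant under multiplication of \<open>t\<close> by q and continuous at 0,
  so its value at \<open>t1\<close> equals its limit along \<open>q ^ n * t1\<close>.\<close>

lemma AW_reduce:
  assumes t: "norm t1 < 1" "norm t2 < 1" "norm t3 < 1" "norm t4 < 1"
  shows "AW t1 t2 t3 t4 * (qp (t1 * t2) * qp (t1 * t3) * qp (t1 * t4)) = AW 0 t2 t3 t4 * qp (t1 * t2 * t3 * t4)"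
proof -
  define F where "F = (\<lambda>t. AW t t2 t3 t4 * (qp (t * t2) * qp (t * t3) * qp (t * t4)) / qp (t * t2 * t3 * t4))"
  have nz: "qp (t * t2 * t3 * t4) \<noteq> 0" if "norm t < 1" for t
    using that t by (intro qp_nonzero norm_mult_less_1)
  have F_q: "F (of_real q * t) = F t" if t': "norm t < 1" for t
  proof -
    have "1 - t * t2 * t3 * t4 \<noteq> 0"
      using nz[OF t'] qp_rec[of "t * t2 * t3 * t4"] by auto
    moreover have "F t = (1 - t * t2) * (1 - t * t3) * (1 - t * t4) * AW t t2 t3 t4
        * (qp (of_real q * (t * t2)) * qp (of_real q * (t * t3)) * qp (of_real q * (t * t4)))
        / ((1 - t * t2 * t3 * t4) * qp (of_real q * (t * t2 * t3 * t4)))"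
      unfolding F_def qp_rec[of "t * t2"] qp_rec[of "t * t3"] qp_rec[of "t * t4"] qp_rec[of "t * t2 * t3 * t4"]
      by (simp add: mult_ac)
    ultimately show ?thesis
      unfolding AW_q_shift[OF t' t(2-4), symmetric] by (simp add: F_def mult.assoc)
  qed
  have F_pow: "F (of_real q ^ n * t1) = F t1 \<and> norm (of_real q ^ n * t1) < 1" for n
  proof (induction n)
    case (Suc n)
    thus ?case using F_q[of "of_real q ^ n * t1"] norm_q_mult[of "of_real q ^ n * t1"] by (simp add: mult_ac)
  qed (use t in auto)
  have "continuous_on (ball 0 1) F"
    unfolding F_def using nz t by (intro continuous_intros AW_continuous) auto
  hence "isCont F 0"
    by (simp add: continuous_on_eq_continuous_at)
  moreover have "(\<lambda>n. of_real q ^ n * t1) \<longlonglongrightarrow> 0"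
    using q_pos q_less_1 by (intro tendsto_mult_left_zero LIMSEQ_power_zero) auto
  ultimately have "(\<lambda>n. F (of_real q ^ n * t1)) \<longlonglongrightarrow> F 0"
    by (rule isCont_tendsto_compose)
  hence "(\<lambda>n. F t1) \<longlonglongrightarrow> F 0"
    using F_pow by simp
  hence "F t1 = F 0"
    by (rule LIMSEQ_unique[OF tendsto_const])
  thus ?thesis using nz[OF t(1)] by (simp add: F_def field_simps)
qed

lemma AW_rotate: "AW t1 t2 t3 t4 = AW t2 t3 t4 t1"
  by (simp add: AW_def mult_ac)

text \<open>\<open>AW_reduce\<close> sends the parameters to 0 one after the other, with
  \<open>AW_rotate\<close> bringing the next one to the front; the pairwise products
  accumulate.\<close>

lemma AW_eval_up_to_const:
  assumes t: "norm t1 < 1" "norm t2 < 1" "norm t3 < 1" "norm t4 < 1"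
  shows "AW t1 t2 t3 t4 * (qp (t1 * t2) * qp (t1 * t3) * qp (t1 * t4) * qp (t2 * t3) * qp (t2 * t4) * qp (t3 * t4))
       = AW 0 0 0 0 * qp (t1 * t2 * t3 * t4)"
proof -
  have "AW t2 t3 t4 0 * (qp (t2 * t3) * qp (t2 * t4)) = AW t3 t4 0 0"
    using AW_reduce[OF t(2-4), of 0] AW_rotate[of 0 t3 t4 0] by simp
  moreover have "AW t3 t4 0 0 * qp (t3 * t4) = AW t4 0 0 0"
    using AW_reduce[OF t(3,4), of 0 0] AW_rotate[of 0 t4 0 0] by simp
  moreover have "AW t4 0 0 0 = AW 0 0 0 0"
    using AW_reduce[OF t(4), of 0 0 0] by simp
  ultimately have 1: "AW t2 t3 t4 0 * (qp (t2 * t3) * qp (t2 * t4)) * qp (t3 * t4) = AW 0 0 0 0"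
    by simp
  have 2: "AW t1 t2 t3 t4 * (qp (t1 * t2) * qp (t1 * t3) * qp (t1 * t4)) = AW t2 t3 t4 0 * qp (t1 * t2 * t3 * t4)"
    using AW_reduce[OF t] AW_rotate[of 0 t2 t3 t4] by simp
  have "x * (a * b * c * d * e * f) = z * w" if "y * (d * e) * f = z" "x * (a * b * c) = y * w"
    for a b c d e f x y z w :: complex
  proof -
    have "x * (a * b * c * d * e * f) = x * (a * b * c) * (d * e * f)" by (simp only: mult_ac)
    also have "\<dots> = y * (d * e) * f * w" unfolding that(2) by (simp only: mult_ac)
    finally show ?thesis using that(1) by simp
  qed
  from this[OF 1 2] show ?thesis .
qed

section \<open>The normalizing constant of the integral\<close>

lemma integral_sin_sq_cis: "integral {0..pi} (\<lambda>\<phi>. (1 - cis \<phi> ^ 2) * (1 - 1 / cis \<phi> ^ 2)) = of_real (2 * pi)"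
proof -
  have "((\<lambda>\<phi>. 2 - 2 * cos (2 * \<phi>)) has_integral (2 * pi - sin (2 * pi)) - (2 * 0 - sin (2 * 0))) {0..pi}"
    by (rule fundamental_theorem_of_calculus) (auto intro!: derivative_eq_intros simp flip: has_real_derivative_iff_has_vector_derivative)
  from has_integral_linear[OF this bounded_linear_of_real[where 'a = complex]]
  have "((\<lambda>\<phi>. of_real (2 - 2 * cos (2 * \<phi>)) :: complex) has_integral of_real (2 * pi)) {0..pi}"
    by (simp add: o_def)
  moreover have "(1 - cis \<phi> ^ 2) * (1 - 1 / cis \<phi> ^ 2) = of_real (2 - 2 * cos (2 * \<phi>))" for \<phi>
  proof -
    have "(1 - cis \<phi> ^ 2) * (1 - 1 / cis \<phi> ^ 2) = 2 - (cis (2 * \<phi>) + cis (- (2 * \<phi>)))"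
      unfolding cis_minus by (simp add: Complex.DeMoivre field_simps)
    thus ?thesis by (simp add: complex_eq_iff)
  qed
  ultimately show ?thesis by (simp add: integral_unique)
qed

lemma AW_0: "AW 0 0 0 0 = 1"
proof -
  let ?q = "of_real q :: complex"
  have s: "norm s < 1" "s * s = ?q" using sqrt_q by auto
  have nz: "qp ?q \<noteq> 0" using q_pos q_less_1 by (intro qp_nonzero) auto
  \<comment> \<open>The duplication formula with the factors \<open>1 - z\<close> and
    \<open>1 + z\<close> split off. What is left are exactly the four parameters q, -q, s, -s, which
    cancel the denominator of the integrand.\<close>
  have sq: "qp (z\<^sup>2) = (1 - z\<^sup>2) * (qp (?q * z) * qp (- ?q * z) * qp (s * z) * qp (- s * z))" for z
    using qp_dup[of z] qp_rec[of z] qp_rec[of "-z"] by (simp add: power2_eq_square algebra_simps)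
  have "wt \<phi> / (hh ?q (cis \<phi>) * hh (-?q) (cis \<phi>) * hh s (cis \<phi>) * hh (-s) (cis \<phi>))
        = qp ?q / of_real (2 * pi) * ((1 - cis \<phi> ^ 2) * (1 - 1 / cis \<phi> ^ 2))" for \<phi>
  proof -
    define z where "z = cis \<phi>"
    have "hh ?q z \<noteq> 0" "hh (-?q) z \<noteq> 0" "hh s z \<noteq> 0" "hh (-s) z \<noteq> 0"
      using s q_pos q_less_1 by (simp_all add: z_def)
    moreover have "qp (z\<^sup>2) * qp ((1 / z)\<^sup>2) = (1 - z\<^sup>2) * (1 - (1/z)\<^sup>2) * (hh ?q z * hh (-?q) z * hh s z * hh (-s) z)"
      unfolding sq hh_def by simp
    ultimately show ?thesis
      unfolding wt_def z_def[symmetric] by (simp add: power_divide mult.assoc)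
  qed
  hence "AW ?q (-?q) s (-s) = qp ?q"
    unfolding AW_def by (simp add: integral_sin_sq_cis)
  hence 1: "qp ?q * (qp (- (?q * ?q)) * qp (?q * s) * qp (- (?q * s)) * qp (- (?q * s)) * qp (?q * s) * qp (- ?q)) = AW 0 0 0 0 * qp (?q * ?q * ?q)"
    using AW_eval_up_to_const[of ?q "-?q" s "-s"] s q_pos q_less_1 by (simp add: mult.assoc)
  \<comment> \<open>Duplication at \<open>s\<close>, divided by \<open>qp ?q\<close>, is Euler's
    identity that the product of all \<open>1 - q ^ (2 * k + 1)\<close> is inverse to
    \<open>qp (- q)\<close>.\<close>
  have "qp ?q = qp s * qp (- s) * qp ?q * qp (- ?q)"
    using qp_dup[of s] s(2) by (simp add: power2_eq_square)
  hence "qp s * qp (- s) * qp (- ?q) = 1" using nz by (simp add: mult.assoc)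
  moreover have "qp s * qp (- s) = (1 - ?q) * (qp (?q * s) * qp (- (?q * s)))"
  proof -
    have "qp s * qp (- s) = ((1 - s) * (1 + s)) * (qp (?q * s) * qp (- (?q * s)))"
      using qp_rec[of s] qp_rec[of "-s"] by simp
    thus ?thesis using s(2) by (simp add: algebra_simps)
  qed
  ultimately have 2: "(1 - ?q) * (qp (?q * s) * qp (- (?q * s)) * qp (- ?q)) = 1" by (simp add: mult.assoc)
  have 3: "qp (- ?q) = (1 + ?q) * qp (- (?q * ?q))"
    using qp_rec[of "- ?q"] by simp
  have "(1 - ?q * ?q) = (1 - ?q) * (1 + ?q)" by (simp add: algebra_simps)
  moreover have "qp (?q * ?q) = (1 - ?q * ?q) * qp (?q * ?q * ?q)"
    by (subst qp_rec) (simp only: mult.assoc)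
  ultimately have 4: "qp ?q = (1 - ?q) * ((1 - ?q) * (1 + ?q) * qp (?q * ?q * ?q))"
    by (subst qp_rec) (simp only:)
  have 5: "qp (?q * ?q * ?q) \<noteq> 0" using 4 nz by auto
  \<comment> \<open>The remaining factors group into two copies of Euler's product, each equal to 1
    by \<open>2\<close>; the first copy needs \<open>3\<close> to restore
    \<open>qp (- ?q)\<close>.\<close>
  have "AW 0 0 0 0 * qp (?q * ?q * ?q) = qp (?q * ?q * ?q) * 
     ((1 - ?q) * (qp (?q * s) * qp (- (?q * s)) * ((1 + ?q) * qp (- (?q * ?q))))) * 
     ((1 - ?q) * (qp (?q * s) * qp (- (?q * s)) * qp (- ?q)))"
    unfolding 1[symmetric] 4 by (simp only: mult_ac)
  also have "\<dots> = qp (?q * ?q * ?q)"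
    unfolding 3[symmetric] 2 by simp
  finally show ?thesis using 5 by simp
qed

theorem Askey_Wilson_integral:
  assumes t: "norm t1 < 1" "norm t2 < 1" "norm t3 < 1" "norm t4 < 1"
  shows "AW t1 t2 t3 t4 = qp (t1 * t2 * t3 * t4) / 
           (qp (t1 * t2) * qp (t1 * t3) * qp (t1 * t4) * qp (t2 * t3) * qp (t2 * t4) * qp (t3 * t4))"
proof -
  have "qp (t1 * t2) \<noteq> 0" "qp (t1 * t3) \<noteq> 0" "qp (t1 * t4) \<noteq> 0" "qp (t2 * t3) \<noteq> 0" "qp (t2 * t4) \<noteq> 0" "qp (t3 * t4) \<noteq> 0"
    using t by (auto intro!: qp_nonzero norm_mult_less_1)
  thus ?thesis using AW_eval_up_to_const[OF t] by (simp add: AW_0 eq_divide_eq)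
qed

section \<open>The operators as conjugated Poisson operators\<close>

abbreviation qpw :: "real \<Rightarrow> complex" where "qpw a \<equiv> of_real (q powr a)"

text \<open>\<open>hc c z\<close> is \<open>h(x; -1/c, -cq)\<close>; the outer factor of \<open>\<K>\<^sub>a\<^sub>,\<^sub>c\<close> is \<open>hc (c q\<^sup>-\<^sup>a\<^sup>/\<^sup>2)\<close>.\<close>

definition hc :: "complex \<Rightarrow> complex \<Rightarrow> complex" where
  "hc c z = hh (- 1 / c) z * hh (- c * of_real q) z"

definition Kconst :: "real \<Rightarrow> complex \<Rightarrow> complex" where
  "Kconst a c = qpw (a * (a - 3) / 4) * (of_real (1 - q) / (2 * c)) powr of_real a"

text \<open>
  The \<open>q\<close>-Mehler kernel \<open>\<Sum>\<^sub>n H\<^sub>n(x|q) H\<^sub>n(cos \<phi>|q) r\<^sup>n / (q;q)\<^sub>n\<close> in closed form, times the weight.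
\<close>

definition PK :: "complex \<Rightarrow> complex \<Rightarrow> real \<Rightarrow> complex" where
  "PK r z \<phi> = wt \<phi> * qp (r * r) / (hh (r * z) (cis \<phi>) * hh (r / z) (cis \<phi>))"

section \<open>Rewriting the operators in terms of \<open>PK\<close> and \<open>hc\<close>\<close>

lemma h_prod_two: "h_prod q z [a, b] = hh a z * hh b z"
  by (simp add: h_prod_def hh_def)

lemma qpw_pos: "q powr a > 0"
  using q_pos by simp

lemma qpw_less_1: "a > 0 \<Longrightarrow> q powr a < 1"
  using q_pos q_less_1 by (simp add: powr01_less_one)

lemma qpw_add: "qpw (a + b) = qpw a * qpw b"
  by (simp add: powr_add)

lemma qpw_nonzero [simp]: "qpw a \<noteq> 0"
  using q_pos by simp

lemma norm_qpw: "norm (qpw a) = q powr a"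
  using q_pos by simp

lemma admissible_iff: "admissible q c \<longleftrightarrow> c \<noteq> 0 \<and> (\<forall>\<phi>\<in>{0..pi}. hc c (cis \<phi>) \<noteq> 0)"
  by (simp add: admissible_def h_prod_two hc_def)

lemma w_H_eq_wt:
  assumes "\<phi> \<in> {0..pi}"
  shows "w_H q (cos \<phi>) * of_real (sin \<phi>) = wt \<phi>"
proof -
  have ac: "arccos (cos \<phi>) = \<phi>" using assms by (simp add: arccos_cos)
  have sn: "sin \<phi> \<ge> 0" using assms by (simp add: sin_ge_zero)
  hence sq: "sqrt (1 - (cos \<phi>)\<^sup>2) = sin \<phi>"
    by (simp add: sin_squared_eq[symmetric])
  have cs: "cis (2 * \<phi>) = cis \<phi> ^ 2" "cis (- (2 * \<phi>)) = 1 / cis \<phi> ^ 2"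
    using cis_minus[of "2 * \<phi>"] by (simp_all add: Complex.DeMoivre)
  show ?thesis
  proof (cases "sin \<phi> = 0")
    \<comment> \<open>At the endpoints the left side is 0 because of sin \<phi>, and
      \<open>wt\<close> vanishes there because \<open>qp 1 = 0\<close>.\<close>
    case True
    hence "cis \<phi> ^ 2 = 1"
      using sin_cos_squared_add[of \<phi>] by (simp add: complex_eq_iff power2_eq_square)
    moreover have "qp 1 = 0" using qp_rec[of 1] by simp
    ultimately show ?thesis using True by (simp add: wt_def)
  next
    case False
    thus ?thesis by (simp add: w_H_def Let_def ac sq cs wt_def)
  qed
qed

text \<open>This exhibits the conjugation: divide by \<open>hc c\<close>, apply the Poisson operator
  of radius \<open>q powr (a / 2)\<close>, multiply by \<open>hc\<close> at the shifted index. The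
  two parameters of the outer h are those of \<open>hc\<close> at \<open>c * qpw (- a / 2)\<close>,
  and \<open>qp (qpw a)\<close> is the numerator \<open>qp (r * r)\<close> of the kernel.\<close>

lemma K_ext_eq:
  "K_ext q a c f z = Kconst a c * hc (c * qpw (- a / 2)) z *
     integral {0..pi} (\<lambda>\<phi>. PK (qpw (a / 2)) z \<phi> * (f (cos \<phi>) / hc c (cis \<phi>)))"
proof -
  have 1: "h_prod q z [- c * qpw (1 - a / 2), - qpw (a / 2) / c] = hc (c * qpw (- a / 2)) z"
  proof -
    have "qpw (1 - a / 2) = qpw (- a / 2) * of_real q"
      using qpw_add[of "- a / 2" 1] q_pos by (simp add: add.commute)
    hence "- c * qpw (1 - a / 2) = - (c * qpw (- a / 2)) * of_real q" by simp
    moreover have "- qpw (a / 2) / c = - 1 / (c * qpw (- a / 2))"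
      by (simp add: powr_minus field_simps)
    ultimately show ?thesis by (simp only: h_prod_two hc_def mult.commute)
  qed
  have "qpw a = qpw (a / 2) * qpw (a / 2)"
    unfolding qpw_add[symmetric] by simp
  hence 2: "w_H q (cos \<phi>) * qp (qpw a) * f (cos \<phi>) * of_real (sin \<phi>) / 
           (h_prod q (cis \<phi>) [qpw (a / 2) * z, qpw (a / 2) / z]
            * h_prod q (cis \<phi>) [- 1 / c, - c * of_real q])
         = PK (qpw (a / 2)) z \<phi> * (f (cos \<phi>) / hc c (cis \<phi>))" if "\<phi> \<in> {0..pi}" for \<phi>
    unfolding PK_def w_H_eq_wt[OF that, symmetric] h_prod_two hc_def by simp
  show ?thesis
    unfolding K_ext_def 1 Kconst_def by (intro arg_cong2[of _ _ _ _ "(*)"] refl integral_cong 2)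
qed

lemma K_op_cos: "\<phi> \<in> {0..pi} \<Longrightarrow> K_op q a c f (cos \<phi>) = K_ext q a c f (cis \<phi>)"
  by (simp add: K_op_def arccos_cos)

section \<open>Continuity, mass and composition law of the Poisson kernel\<close>

lemma hc_continuous [continuous_intros]:
  "continuous_on S f \<Longrightarrow> continuous_on S g \<Longrightarrow> (\<And>x. x \<in> S \<Longrightarrow> f x \<noteq> 0) \<Longrightarrow> (\<And>x. x \<in> S \<Longrightarrow> g x \<noteq> 0) \<Longrightarrow>
   continuous_on S (\<lambda>x. hc (f x) (g x))"
  unfolding hc_def by (intro continuous_intros) auto

lemma PK_continuous [continuous_intros]:
  assumes "continuous_on S r" "continuous_on S z" "continuous_on S \<phi>"
    and "\<And>x. x \<in> S \<Longrightarrow> norm (r x * z x) < 1" "\<And>x. x \<in> S \<Longrightarrow> norm (r x / z x) < 1"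
    and "\<And>x. x \<in> S \<Longrightarrow> z x \<noteq> 0"
  shows "continuous_on S (\<lambda>x. PK (r x) (z x) (\<phi> x))"
  unfolding PK_def using assms by (intro continuous_intros) auto

text \<open>This is the Askey-Wilson integral with parameters \<open>r * z\<close>,
  \<open>r / z\<close>, 0, 0, where only the pair product \<open>r * r\<close> survives.\<close>

lemma PK_mass:
  assumes "norm r < 1" "norm z = 1"
  shows "integral {0..pi} (PK r z) = 1"
proof -
  have n: "norm (r * z) < 1" "norm (r / z) < 1" "norm (r * r) < 1"
    using assms by (auto simp: norm_divide norm_mult_less_1) (simp add: norm_mult)
  have z0: "z \<noteq> 0" using assms by auto
  have "PK r z = (\<lambda>\<phi>. qp (r * r) * (wt \<phi> / (hh (r * z) (cis \<phi>) * hh (r / z) (cis \<phi>) * hh 0 (cis \<phi>) * hh 0 (cis \<phi>))))"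
    by (auto simp: PK_def fun_eq_iff)
  hence "integral {0..pi} (PK r z) = qp (r * r) * AW (r * z) (r / z) 0 0"
    unfolding AW_def by (simp only: integral_mult_right)
  also have "AW (r * z) (r / z) 0 0 = 1 / qp (r * r)"
    using Askey_Wilson_integral[of "r * z" "r / z" 0 0] n z0 by simp
  finally show ?thesis using qp_nonzero[OF n(3)] by simp
qed

text \<open>As a function of \<phi> the product of kernels is an Askey-Wilson integrand with
  parameters \<open>t * z\<close>, \<open>t / z\<close>, \<open>r * w\<close>, \<open>r / w\<close>.
  The four mixed pair products form the denominator of the kernel of radius \<open>r * t\<close>,
  the product of all four gives its numerator, and the other two pairs cancel
  \<open>qp (t * t)\<close> and \<open>qp (r * r)\<close>.\<close>

lemma PK_semigroup:
  assumes r: "norm r < 1" and t: "norm t < 1" and z: "norm z = 1"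
  shows "integral {0..pi} (\<lambda>\<phi>. PK t z \<phi> * PK r (cis \<phi>) \<psi>) = PK (r * t) z \<psi>"
proof -
  define w where "w = cis \<psi>"
  have z0: "z \<noteq> 0" and w0: "w \<noteq> 0" using z by (auto simp: w_def)
  have n: "norm (t * z) < 1" "norm (t / z) < 1" "norm (r * w) < 1" "norm (r / w) < 1" 
    using r t z by (auto simp: norm_divide norm_mult w_def)
  have nz: "qp (r * r) \<noteq> 0" "qp (t * t) \<noteq> 0"
    using r t by (auto intro!: qp_nonzero norm_mult_less_1)
  have "PK t z \<phi> * PK r (cis \<phi>) \<psi> = (wt \<psi> * qp (t * t) * qp (r * r)) * 
     (wt \<phi> / (hh (t * z) (cis \<phi>) * hh (t / z) (cis \<phi>) * hh (r * w) (cis \<phi>) * hh (r / w) (cis \<phi>)))" for \<phi>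
    unfolding PK_def w_def[symmetric] by (simp add: hh_def mult_ac)
  hence "integral {0..pi} (\<lambda>\<phi>. PK t z \<phi> * PK r (cis \<phi>) \<psi>) = 
    (wt \<psi> * qp (t * t) * qp (r * r)) * AW (t * z) (t / z) (r * w) (r / w)"
    unfolding AW_def by (simp only: integral_mult_right)
  also have "AW (t * z) (t / z) (r * w) (r / w) = qp ((r * t) * (r * t)) / 
     (qp (t * t) * qp (r * t * z * w) * qp (r * t * z / w) * qp (r * t / z * w) * qp (r * t / z / w) * qp (r * r))"
    unfolding Askey_Wilson_integral[OF n] using z0 w0 by (simp add: mult_ac)
  also have "wt \<psi> * qp (t * t) * qp (r * r) * \<dots> = PK (r * t) z \<psi>"
    unfolding PK_def hh_def w_def[symmetric] using nz by (simp add: mult_ac)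
  finally show ?thesis .
qed

text \<open>A positive real factor does not change the argument, so the principal logarithm is
  additive here and no branch jump occurs.\<close>

lemma powr_mult_of_real_left:
  assumes "p > 0" "w \<noteq> 0"
  shows "(w * of_real p) powr (of_real b :: complex) = w powr of_real b * of_real (p powr b)"
proof -
  have "Ln (w * of_real p) = of_real (ln p) + Ln w"
    using assms Ln_times_of_real[of p w] by (simp add: mult.commute Ln_of_real)
  thus ?thesis
    using assms by (simp add: powr_def exp_add distrib_left exp_of_real[symmetric])
qed

text \<open>The index shift inside the power contributes the exponent \<open>a * b / 2\<close>,
  precisely the cross term of \<open>(a + b) * (a + b - 3) / 4\<close>.\<close>

lemma Kconst_mult:
  assumes "c \<noteq> 0"
  shows "Kconst b (c * qpw (- a / 2)) * Kconst a c = Kconst (a + b) c"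
proof -
  define w where "w = of_real (1 - q) / (2 * c)"
  have w0: "w \<noteq> 0" using assms q_less_1 by (simp add: w_def)
  have "of_real (1 - q) / (2 * (c * qpw (- a / 2))) = w * qpw (a / 2)"
    by (simp add: w_def powr_minus field_simps)
  hence "Kconst b (c * qpw (- a / 2)) = qpw (b * (b - 3) / 4) * (w powr of_real b * of_real ((q powr (a / 2)) powr b))"
    unfolding Kconst_def using powr_mult_of_real_left[OF qpw_pos w0] by simp
  also have "(q powr (a / 2)) powr b = q powr (a * b / 2)"
    by (simp add: powr_powr)
  finally have Kb: "Kconst b (c * qpw (- a / 2)) = qpw (b * (b - 3) / 4) * (w powr of_real b * qpw (a * b / 2))" .
  have "Kconst b (c * qpw (- a / 2)) * Kconst a c = 
     (qpw (b * (b - 3) / 4) * qpw (a * b / 2) * qpw (a * (a - 3) / 4)) * (w powr of_real a * w powr of_real b)"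
    unfolding Kb unfolding Kconst_def w_def[symmetric] by (simp only: mult_ac)
  also have "w powr of_real a * w powr of_real b = w powr of_real (a + b)"
    by (simp add: powr_add)
  also have "qpw (b * (b - 3) / 4) * qpw (a * b / 2) * qpw (a * (a - 3) / 4) = qpw ((a + b) * (a + b - 3) / 4)"
    unfolding qpw_add[symmetric] by (intro arg_cong[of _ _ qpw]) (simp add: field_simps)
  finally show ?thesis by (simp add: Kconst_def w_def)
qed

lemma quotient_continuous:
  assumes "admissible q c" "continuous_on {-1..1} f"
  shows "continuous_on {0..pi} (\<lambda>\<phi>. f (cos \<phi>) / hc c (cis \<phi>))"
  using assms unfolding admissible_iff
  by (intro continuous_intros continuous_on_compose2[OF assms(2)]) auto

theorem K_op_semigroup:
  assumes a: "a > 0" and b: "b > 0" and c: "admissible q c" and c': "admissible q (c * qpw (- a / 2))"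
    and f: "continuous_on {-1..1} f" and x: "x \<in> {-1..1}"
  shows "K_op q b (c * qpw (- a / 2)) (K_op q a c f) x = K_op q (a + b) c f x"
proof -
  define r where "r = qpw (a / 2)"
  define t where "t = qpw (b / 2)"
  define g where "g = (\<lambda>\<phi>. f (cos \<phi>) / hc c (cis \<phi>))"
  define z where "z = cis (arccos x)"
  define c1 where "c1 = c * qpw (- a / 2)"
  have r: "norm r < 1" and t: "norm t < 1"
    using a b by (auto simp: r_def t_def norm_qpw qpw_less_1)
  have z: "norm z = 1" "z \<noteq> 0" by (auto simp: z_def)
  have g: "continuous_on {0..pi} g"
    unfolding g_def using quotient_continuous[OF c f] .
  have c1: "c1 \<noteq> 0" "\<phi> \<in> {0..pi} \<Longrightarrow> hc c1 (cis \<phi>) \<noteq> 0" for \<phi>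
    using c' by (auto simp: admissible_iff c1_def)
  have c2: "c1 * qpw (- b / 2) = c * qpw (- (a + b) / 2)"
  proof -
    have "- (a + b) / 2 = (- a / 2) + (- b / 2)" by (simp add: field_simps)
    thus ?thesis unfolding c1_def by (simp only: qpw_add mult.assoc)
  qed
  have rt: "r * t = qpw ((a + b) / 2)"
    unfolding r_def t_def qpw_add[symmetric] by (simp add: add_divide_distrib)
  have "integral {0..pi} (\<lambda>\<phi>. PK t z \<phi> * (K_op q a c f (cos \<phi>) / hc c1 (cis \<phi>)))
      = integral {0..pi} (\<lambda>\<phi>. Kconst a c * integral {0..pi} (\<lambda>\<psi>. PK t z \<phi> * PK r (cis \<phi>) \<psi> * g \<psi>))"
  proof (intro integral_cong)
    fix \<phi> assume \<phi>: "\<phi> \<in> {0..pi}"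
    \<comment> \<open>The inner operator multiplies by \<open>hc c1\<close>, exactly what the outer
      one divides by; admissibility of the shifted index makes the cancellation legitimate.\<close>
    have "K_op q a c f (cos \<phi>) / hc c1 (cis \<phi>) = Kconst a c * integral {0..pi} (\<lambda>\<psi>. PK r (cis \<phi>) \<psi> * g \<psi>)"
      unfolding K_op_cos[OF \<phi>] K_ext_eq c1_def[symmetric] r_def[symmetric] g_def using c1(2)[OF \<phi>] by simp
    thus "PK t z \<phi> * (K_op q a c f (cos \<phi>) / hc c1 (cis \<phi>)) = 
       Kconst a c * integral {0..pi} (\<lambda>\<psi>. PK t z \<phi> * PK r (cis \<phi>) \<psi> * g \<psi>)"
      by (simp add: mult.assoc mult.left_commute)
  qed
  also have "\<dots> = Kconst a c * integral {0..pi} (\<lambda>\<phi>. integral {0..pi} (\<lambda>\<psi>. PK t z \<phi> * PK r (cis \<phi>) \<psi> * g \<psi>))"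
    by simp
  also have "integral {0..pi} (\<lambda>\<phi>. integral {0..pi} (\<lambda>\<psi>. PK t z \<phi> * PK r (cis \<phi>) \<psi> * g \<psi>)) = 
             integral {0..pi} (\<lambda>\<psi>. integral {0..pi} (\<lambda>\<phi>. PK t z \<phi> * PK r (cis \<phi>) \<psi> * g \<psi>))"
  proof -
    \<comment> \<open>Both radii are below 1, so the integrand is continuous on the closed square
      and the order of integration may be exchanged.\<close>
    have "continuous_on (cbox (0, 0) (pi, pi)) (\<lambda>(\<phi>, \<psi>). PK t z \<phi> * PK r (cis \<phi>) \<psi> * g \<psi>)"
      unfolding case_prod_unfold using r t z
      by (intro continuous_intros continuous_on_compose2[OF g]) (auto simp: norm_mult norm_divide)
    thus ?thesis
      using integral_swap_continuous[of 0 0 pi pi "\<lambda>\<phi> \<psi>. PK t z \<phi> * PK r (cis \<phi>) \<psi> * g \<psi>"] by simp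
  qed
  also have "\<dots> = integral {0..pi} (\<lambda>\<psi>. PK (r * t) z \<psi> * g \<psi>)"
    using PK_semigroup[OF r t z(1)] by simp
  finally have "K_op q b c1 (K_op q a c f) x = (Kconst b c1 * Kconst a c) * hc (c1 * qpw (- b / 2)) z * 
     integral {0..pi} (\<lambda>\<psi>. PK (r * t) z \<psi> * g \<psi>)"
    unfolding K_op_def[of _ b] K_ext_eq[of b] z_def[symmetric] t_def[symmetric] by simp
  also have "\<dots> = K_op q (a + b) c f x"
    unfolding K_op_def K_ext_eq z_def[symmetric] g_def c2 rt 
    using Kconst_mult[of c b a] c by (simp add: c1_def admissible_iff)
  finally show ?thesis by (simp add: c1_def)
qed

section \<open>The limit \<open>a \<rightarrow> 0\<close>\<close>

lemma qp_nonneg: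
  assumes "0 \<le> x" "x \<le> 1"
  shows "qp (of_real x) \<in> \<real>\<^sub>\<ge>\<^sub>0"
proof (rule closed_sequentially[OF closed_nonneg_Reals_complex _ qp_LIMSEQ])
  have "x * q ^ k \<le> 1" for k
    using assms q_pos q_less_1 by (simp add: mult_le_one power_le_one)
  hence "(\<Prod>k<n. of_real (1 - x * q ^ k) :: complex) \<in> \<real>\<^sub>\<ge>\<^sub>0" for n
    unfolding of_real_prod[symmetric] nonneg_Reals_of_real_iff by (intro prod_nonneg) auto
  thus "(\<Prod>k<n. 1 - of_real x * of_real q ^ k :: complex) \<in> \<real>\<^sub>\<ge>\<^sub>0" for n
    by simp
qed

lemma mult_cnj_nonneg: "z * cnj z \<in> \<real>\<^sub>\<ge>\<^sub>0"
  by (simp add: complex_norm_square[symmetric] flip: of_real_power)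

text \<open>Conjugation inverts points of the unit circle, so the factors of the weight and of the
  denominator pair off into products \<open>x * cnj x\<close>; only \<open>qp q\<close> and
  \<open>qp (r * r)\<close> are left, both nonnegative.\<close>

lemma PK_nonneg:
  assumes "0 \<le> r" "r < 1"
  shows "PK (of_real r) (cis \<theta>) \<phi> \<in> \<real>\<^sub>\<ge>\<^sub>0"
proof -
  define z where "z = cis \<theta>"
  define w where "w = cis \<phi>"
  have cnj: "cnj z = 1 / z" "cnj w = 1 / w"
    by (simp_all add: z_def w_def cis_cnj cis_minus)
  have "wt \<phi> = qp (of_real q) * (qp (w\<^sup>2) * cnj (qp (w\<^sup>2))) / of_real (2 * pi)"
    unfolding wt_def w_def[symmetric] qp_cnj[symmetric] by (simp add: cnj power_divide)
  hence 1: "wt \<phi> \<in> \<real>\<^sub>\<ge>\<^sub>0"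
    using qp_nonneg[of q] q_pos q_less_1
    by (simp only:) (intro nonneg_Reals_mult_I nonneg_Reals_divide_I mult_cnj_nonneg, auto)
  have "qp (of_real (r * r)) \<in> \<real>\<^sub>\<ge>\<^sub>0"
    using assms by (intro qp_nonneg) (auto simp: mult_le_one)
  hence 2: "qp (of_real r * of_real r) \<in> \<real>\<^sub>\<ge>\<^sub>0" by simp
  have "hh (of_real r * z) w * hh (of_real r / z) w = 
     (qp (of_real r * z * w) * cnj (qp (of_real r * z * w))) * (qp (of_real r * z / w) * cnj (qp (of_real r * z / w)))"
    unfolding hh_def qp_cnj[symmetric] by (simp add: cnj)
  also have "\<dots> \<in> \<real>\<^sub>\<ge>\<^sub>0"
    by (intro nonneg_Reals_mult_I mult_cnj_nonneg)
  finally show ?thesis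
    unfolding PK_def z_def w_def by (rule nonneg_Reals_divide_I[OF nonneg_Reals_mult_I[OF 1 2]])
qed

lemma PK_norm_mass:
  assumes "0 \<le> r" "r < 1"
  shows "integral {0..pi} (\<lambda>\<phi>. norm (PK (of_real r) (cis \<theta>) \<phi>)) = 1"
proof -
  have "of_real (norm (PK (of_real r) (cis \<theta>) \<phi>)) = PK (of_real r) (cis \<theta>) \<phi>" for \<phi>
    using PK_nonneg[OF assms, of \<theta> \<phi>] by (auto elim!: nonneg_Reals_cases)
  hence "integral {0..pi} (\<lambda>\<phi>. of_real (norm (PK (of_real r) (cis \<theta>) \<phi>)) :: complex) = 1"
    using PK_mass[of "of_real r" "cis \<theta>"] assms by (simp add: fun_eq_iff)
  moreover have "(\<lambda>\<phi>. norm (PK (of_real r) (cis \<theta>) \<phi>)) integrable_on {0..pi}"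
    using assms by (intro integrable_continuous_interval continuous_intros) (auto simp: norm_mult norm_divide)
  from integral_linear[OF this bounded_linear_of_real[where 'a = complex]]
  have "integral {0..pi} (\<lambda>\<phi>. of_real (norm (PK (of_real r) (cis \<theta>) \<phi>)) :: complex)
      = of_real (integral {0..pi} (\<lambda>\<phi>. norm (PK (of_real r) (cis \<theta>) \<phi>)))"
    by (simp add: o_def)
  ultimately show ?thesis
    by (metis of_real_eq_1_iff)
qed

text \<open>These are the leading factors of the kernel's denominator, the only ones that can vanish
  in the limit \<open>r = 1\<close>.\<close>

lemma Poisson_denominator:
  fixes r \<theta> \<phi> :: real
  assumes "r \<ge> 0"
  defines "z \<equiv> cis \<theta>" and "w \<equiv> cis \<phi>"
  obtains d where
    "(1 - of_real r * z * w) * (1 - of_real r * z / w) * ((1 - of_real r / z * w) * (1 - of_real r / z / w)) = of_real d"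
    "d \<ge> 4 * r\<^sup>2 * (cos \<theta> - cos \<phi>)\<^sup>2"
proof -
  define x y where "x = cos \<theta>" and "y = cos \<phi>"
  \<comment> \<open>The product expanded through \<open>z + 1 / z = 2 * x\<close> and
    \<open>w + 1 / w = 2 * y\<close>.\<close>
  define d where "d = 1 - 4 * x * y * r + r\<^sup>2 * (4 * x\<^sup>2 - 2) + 4 * y\<^sup>2 * r\<^sup>2 - 4 * x * y * r ^ 3 + r ^ 4"
  have z: "z * (1 / z) = 1" "z + 1 / z = of_real (2 * x)"
    by (simp_all add: z_def x_def cis_minus[symmetric] complex_eq_iff)
  have w: "w * (1 / w) = 1" "w + 1 / w = of_real (2 * y)"
    by (simp_all add: w_def y_def cis_minus[symmetric] complex_eq_iff)
  have *: "(1 - t * w) * (1 - t / w) = 1 - 2 * of_real y * t + t\<^sup>2" for t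
  proof -
    have "(1 - t * w) * (1 - t / w) = 1 - t * (w + 1 / w) + t\<^sup>2 * (w * (1 / w))"
      by (simp add: algebra_simps power2_eq_square)
    thus ?thesis unfolding w by simp
  qed
  have "(1 - of_real r * z * w) * (1 - of_real r * z / w) * ((1 - of_real r / z * w) * (1 - of_real r / z / w)) = 
     (1 - 2 * of_real y * (of_real r * z) + (of_real r * z)\<^sup>2) * 
     (1 - 2 * of_real y * (of_real r / z) + (of_real r / z)\<^sup>2)"
    unfolding * ..
  also have "\<dots> = (1 - 2 * of_real y * of_real r * z + of_real r ^ 2 * z\<^sup>2) * 
     (1 - 2 * of_real y * of_real r * (1 / z) + of_real r ^ 2 * (1 / z)\<^sup>2)"
    by (simp add: power_mult_distrib power_divide)
  also have "\<dots> = of_real d"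
  proof -
    define u where "u = 1 / z"
    have u: "z * u = 1" "u = of_real (2 * x) - z" using z by (simp_all add: u_def algebra_simps)
    show ?thesis
      unfolding u_def[symmetric] d_def using u by simp algebra
  qed
  finally have 1: "(1 - of_real r * z * w) * (1 - of_real r * z / w) * ((1 - of_real r / z * w) * (1 - of_real r / z / w)) = of_real d" .
  have "x * y \<le> 1"
    using abs_cos_le_one[of \<theta>] abs_cos_le_one[of \<phi>] mult_le_one[of "\<bar>x\<bar>" "\<bar>y\<bar>"]
    by (auto simp: x_def y_def abs_mult[symmetric])
  \<comment> \<open>The quartic is the desired square plus a remainder that is nonnegative because
    \<open>x * y \<le> 1\<close>.\<close>
  have "d = 4 * r\<^sup>2 * (x - y)\<^sup>2 + (1 - r)\<^sup>2 * ((1 - r)\<^sup>2 + 4 * r * (1 - x * y))"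
    unfolding d_def by (simp add: algebra_simps power2_eq_square power3_eq_cube power4_eq_xxxx)
  moreover have "(1 - r)\<^sup>2 * ((1 - r)\<^sup>2 + 4 * r * (1 - x * y)) \<ge> 0"
    using \<open>r \<ge> 0\<close> \<open>x * y \<le> 1\<close> by (intro mult_nonneg_nonneg add_nonneg_nonneg) auto
  ultimately have "d \<ge> 4 * r\<^sup>2 * (cos \<theta> - cos \<phi>)\<^sup>2" by (simp add: x_def y_def)
  with 1 show ?thesis by (rule that)
qed

text \<open>Splitting the leading factors off numerator and denominator leaves
  \<open>(1 - r\<^sup>2) / d\<close> times \<open>R\<close>. The parameters of \<open>R\<close> have
  modulus at most q, so it is continuous up to \<open>r = 1\<close> and bounded by
  compactness.\<close>

lemma PK_bound:
  obtains M where "M > 0"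
    "\<And>r \<theta> \<phi>. 0 < r \<Longrightarrow> r < 1 \<Longrightarrow> \<theta> \<in> {0..pi} \<Longrightarrow> \<phi> \<in> {0..pi} \<Longrightarrow> cos \<theta> \<noteq> cos \<phi> \<Longrightarrow>
       norm (PK (of_real r) (cis \<theta>) \<phi>) \<le> (1 - r\<^sup>2) * M / (4 * r\<^sup>2 * (cos \<theta> - cos \<phi>)\<^sup>2)"
proof -
  let ?q = "of_real q :: complex"
  define R where "R = (\<lambda>(r::real) \<theta> \<phi>. wt \<phi> * qp (?q * (of_real r * of_real r)) / 
     (hh (?q * (of_real r * cis \<theta>)) (cis \<phi>) * hh (?q * (of_real r / cis \<theta>)) (cis \<phi>)))"
  have "norm (?q * (of_real r * cis \<theta>)) < 1 \<and> norm (?q * (of_real r / cis \<theta>)) < 1"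
    if "0 \<le> r" "r \<le> 1" for r \<theta>
  proof -
    have "q * r < 1" using mult_left_le[OF that(2), of q] q_pos q_less_1 by linarith
    thus ?thesis using that q_pos by (simp add: norm_mult norm_divide)
  qed
  hence "continuous_on ({0..1} \<times> {0..pi} \<times> {0..pi}) (\<lambda>p. R (fst p) (fst (snd p)) (snd (snd p)))"
    unfolding R_def by (intro continuous_intros) auto
  hence "compact ((\<lambda>p. R (fst p) (fst (snd p)) (snd (snd p))) ` ({0..1} \<times> {0..pi} \<times> {0..pi}))"
    by (intro compact_continuous_image compact_Times) auto
  from compact_imp_bounded[OF this] obtain M where M: "M > 0"
    "\<forall>y \<in> (\<lambda>p. R (fst p) (fst (snd p)) (snd (snd p))) ` ({0..1} \<times> {0..pi} \<times> {0..pi}). norm y \<le> M"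
    unfolding bounded_pos by blast
  show ?thesis
  proof (rule that[OF M(1)])
    fix r \<theta> \<phi> :: real assume r: "0 < r" "r < 1" and \<theta>: "\<theta> \<in> {0..pi}" and \<phi>: "\<phi> \<in> {0..pi}" and ne: "cos \<theta> \<noteq> cos \<phi>"
    have R: "norm (R r \<theta> \<phi>) \<le> M" using bspec[OF M(2) imageI[of "(r, \<theta>, \<phi>)"]] r \<theta> \<phi> by simp
    define z where "z = cis \<theta>"
    define w where "w = cis \<phi>"
    obtain d where d: "(1 - of_real r * z * w) * (1 - of_real r * z / w) * ((1 - of_real r / z * w) * (1 - of_real r / z / w)) = of_real d"
        "d \<ge> 4 * r\<^sup>2 * (cos \<theta> - cos \<phi>)\<^sup>2"
      using Poisson_denominator[of r \<theta> \<phi>] r unfolding z_def w_def by auto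
    have pos: "4 * r\<^sup>2 * (cos \<theta> - cos \<phi>)\<^sup>2 > 0" using r ne by simp
    have "hh (of_real r * z) w * hh (of_real r / z) w = of_real d * (hh (?q * (of_real r * z)) w * hh (?q * (of_real r / z)) w)"
      unfolding d(1)[symmetric] by (simp add: hh_q[of "of_real r * z" w, symmetric] hh_q[of "of_real r / z" w, symmetric])
    moreover have "qp (of_real r * of_real r) = of_real (1 - r\<^sup>2) * qp (?q * (of_real r * of_real r))"
      by (subst qp_rec) (simp add: power2_eq_square)
    ultimately have "PK (of_real r) (cis \<theta>) \<phi> = of_real (1 - r\<^sup>2) / of_real d * R r \<theta> \<phi>"
      unfolding PK_def R_def z_def w_def by simp
    hence "norm (PK (of_real r) (cis \<theta>) \<phi>) = norm (of_real (1 - r\<^sup>2) / of_real d :: complex) * norm (R r \<theta> \<phi>)"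
      by (simp only: norm_mult)
    also have "norm (of_real (1 - r\<^sup>2) / of_real d :: complex) = (1 - r\<^sup>2) / d"
      unfolding norm_divide norm_of_real using r d(2) pos by (simp add: power_le_one)
    also have "(1 - r\<^sup>2) / d * norm (R r \<theta> \<phi>) \<le> (1 - r\<^sup>2) / (4 * r\<^sup>2 * (cos \<theta> - cos \<phi>)\<^sup>2) * M"
      using r d(2) pos R by (intro mult_mono divide_left_mono) (auto simp: power_le_one)
    finally show "norm (PK (of_real r) (cis \<theta>) \<phi>) \<le> (1 - r\<^sup>2) * M / (4 * r\<^sup>2 * (cos \<theta> - cos \<phi>)\<^sup>2)"
      by simp
  qed
qed

text \<open>Where cos \<phi> is close to x, uniform continuity of \<open>G\<close> is weighed
  against total mass 1; elsewhere \<open>PK_bound\<close> makes the kernel small, uniformly in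
  x.\<close>

lemma PK_approximate_identity:
  assumes G: "continuous_on {-1..1} G"
  shows "uniform_limit {-1..1} (\<lambda>r x. integral {0..pi} (\<lambda>\<phi>. PK (of_real r) (cis (arccos x)) \<phi> * G (cos \<phi>))) G (at_left 1)"
proof (rule uniform_limitI)
  fix e :: real assume "e > 0"
  obtain M where M: "M > 0"
    "\<And>r \<theta> \<phi>. 0 < r \<Longrightarrow> r < 1 \<Longrightarrow> \<theta> \<in> {0..pi} \<Longrightarrow> \<phi> \<in> {0..pi} \<Longrightarrow> cos \<theta> \<noteq> cos \<phi> \<Longrightarrow>
       norm (PK (of_real r) (cis \<theta>) \<phi>) \<le> (1 - r\<^sup>2) * M / (4 * r\<^sup>2 * (cos \<theta> - cos \<phi>)\<^sup>2)"
    using PK_bound by blast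
  have "bounded (G ` {-1..1})"
    using G by (intro compact_imp_bounded compact_continuous_image) auto
  then obtain B where B: "B > 0" "\<And>y. y \<in> {-1..1} \<Longrightarrow> norm (G y) \<le> B"
    unfolding bounded_pos by auto
  have "uniformly_continuous_on {-1..1} G"
    using G by (intro compact_uniformly_continuous) auto
  then obtain d where d: "d > 0" "\<And>x y. x \<in> {-1..1} \<Longrightarrow> y \<in> {-1..1} \<Longrightarrow> dist y x < d \<Longrightarrow> dist (G y) (G x) < e / 2"
    using \<open>e > 0\<close> unfolding uniformly_continuous_on_def by (metis half_gt_zero)
  \<comment> \<open>The contribution away from x, with the distance replaced by its minimum
    \<open>d\<close> and the oscillation of \<open>G\<close> by \<open>2 * B\<close>; the factor
    \<open>1 - r\<^sup>2\<close> sends it to 0.\<close>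
  have "((\<lambda>r. pi * ((1 - r\<^sup>2) * M / (4 * r\<^sup>2 * d\<^sup>2) * (2 * B))) \<longlongrightarrow> pi * ((1 - 1\<^sup>2) * M / (4 * 1\<^sup>2 * d\<^sup>2) * (2 * B))) (at_left 1)"
    using d(1) by (intro tendsto_intros) auto
  hence "\<forall>\<^sub>F r in at_left 1. pi * ((1 - r\<^sup>2) * M / (4 * r\<^sup>2 * d\<^sup>2) * (2 * B)) < e / 2"
    using \<open>e > 0\<close> by (intro order_tendstoD) auto
  moreover have "\<forall>\<^sub>F r in at_left 1. r \<in> {0<..<(1::real)}"
    by (intro eventually_at_left_real) auto
  ultimately show "\<forall>\<^sub>F r in at_left 1. \<forall>x\<in>{-1..1}. dist (integral {0..pi} (\<lambda>\<phi>. PK (of_real r) (cis (arccos x)) \<phi> * G (cos \<phi>))) (G x) < e"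
  proof eventually_elim
    case (elim r)
    show ?case
    proof
      fix x :: real assume x: "x \<in> {-1..1}"
      define \<theta> where "\<theta> = arccos x"
      have \<theta>: "\<theta> \<in> {0..pi}" "cos \<theta> = x"
        using x by (auto simp: \<theta>_def arccos_lbound arccos_ubound)
      define P where "P = PK (of_real r) (cis \<theta>)"
      have P: "continuous_on A P" for A
        unfolding P_def using elim by (intro continuous_intros) (auto simp: norm_mult norm_divide)
      have cG: "continuous_on {0..pi} (\<lambda>\<phi>. G (cos \<phi>))"
        by (intro continuous_on_compose2[OF G] continuous_intros) auto
      define K where "K = (1 - r\<^sup>2) * M / (4 * r\<^sup>2 * d\<^sup>2) * (2 * B)"
      have K0: "K \<ge> 0" using elim M(1) B(1) by (auto simp: K_def power_le_one)
      have mass: "integral {0..pi} P = 1" "integral {0..pi} (\<lambda>\<phi>. norm (P \<phi>)) = 1"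
        unfolding P_def using elim by (auto intro!: PK_mass PK_norm_mass)
      have "integral {0..pi} (\<lambda>\<phi>. P \<phi> * G (cos \<phi>)) - G x = 
            integral {0..pi} (\<lambda>\<phi>. P \<phi> * G (cos \<phi>)) - integral {0..pi} (\<lambda>\<phi>. P \<phi> * G x)"
        using mass by simp
      also have "\<dots> = integral {0..pi} (\<lambda>\<phi>. P \<phi> * G (cos \<phi>) - P \<phi> * G x)"
        by (rule integral_diff[symmetric]; intro integrable_continuous_interval continuous_intros P cG)
      \<comment> \<open>Adding both bounds gives one majorant valid in either case, so the interval
        need not be split.\<close>
      also have "norm \<dots> \<le> integral {0..pi} (\<lambda>\<phi>. e / 2 * norm (P \<phi>) + K)"
      proof (rule integral_norm_bound_integral)
        fix \<phi> assume \<phi>: "\<phi> \<in> {0..pi}"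
        have eq: "norm (P \<phi> * G (cos \<phi>) - P \<phi> * G x) = norm (P \<phi>) * norm (G (cos \<phi>) - G x)"
          by (simp add: norm_mult flip: right_diff_distrib)
        have y: "cos \<phi> \<in> {-1..1}" by auto
        show "norm (P \<phi> * G (cos \<phi>) - P \<phi> * G x) \<le> e / 2 * norm (P \<phi>) + K"
        proof (cases "\<bar>x - cos \<phi>\<bar> < d")
          case True
          hence "norm (G (cos \<phi>) - G x) \<le> e / 2"
            using d(2)[OF x y] by (auto simp: dist_norm abs_minus_commute)
          hence "norm (P \<phi>) * norm (G (cos \<phi>) - G x) \<le> norm (P \<phi>) * (e / 2)"
            by (intro mult_left_mono) auto
          thus ?thesis unfolding eq using K0 by (simp add: mult.commute)
        next
          case False
          hence "d\<^sup>2 \<le> (x - cos \<phi>)\<^sup>2" using d(1) by (simp add: abs_le_square_iff[symmetric])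
          have "norm (P \<phi>) \<le> (1 - r\<^sup>2) * M / (4 * r\<^sup>2 * (x - cos \<phi>)\<^sup>2)"
            unfolding P_def using M(2)[of r \<theta> \<phi>] elim \<theta> \<phi> False d(1) by auto
          also have "\<dots> \<le> (1 - r\<^sup>2) * M / (4 * r\<^sup>2 * d\<^sup>2)"
            using \<open>d\<^sup>2 \<le> (x - cos \<phi>)\<^sup>2\<close> elim M(1) d(1)
            by (intro divide_left_mono mult_left_mono mult_pos_pos mult_nonneg_nonneg) (auto simp: power_le_one False)
          finally have "norm (P \<phi>) * norm (G (cos \<phi>) - G x) \<le> (1 - r\<^sup>2) * M / (4 * r\<^sup>2 * d\<^sup>2) * (2 * B)"
            using norm_triangle_ineq4[of "G (cos \<phi>)" "G x"] B(2)[OF x] B(2)[OF y]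
            by (intro mult_mono order_trans[OF norm_ge_zero]) auto
          moreover have "0 \<le> e / 2 * norm (P \<phi>)" using \<open>e > 0\<close> by simp
          ultimately show ?thesis unfolding eq K_def by linarith
        qed
      qed (intro integrable_continuous_interval continuous_intros P cG)+
      also have "\<dots> = integral {0..pi} (\<lambda>\<phi>. e / 2 * norm (P \<phi>)) + integral {0..pi} (\<lambda>_. K)"
        by (rule integral_add; intro integrable_continuous_interval continuous_intros P)
      also have "\<dots> = e / 2 + pi * K"
        using mass by simp
      also have "\<dots> < e" using elim unfolding K_def by linarith
      finally show "dist (integral {0..pi} (\<lambda>\<phi>. PK (of_real r) (cis (arccos x)) \<phi> * G (cos \<phi>))) (G x) < e"
        by (simp add: dist_norm P_def \<theta>_def)
    qed
  qed
qed

text \<open>The operator is a factor \<open>E\<close> times the Poisson integral of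
  \<open>f / hc c\<close>. As the order tends to 0 the radius tends to 1 from below and
  \<open>E\<close> tends to \<open>hc c\<close>, undoing the division; since both limits are
  bounded, the product converges uniformly.\<close>

theorem K_op_tendsto_identity:
  assumes c: "admissible q c" and f: "continuous_on {-1..1} f"
  shows "uniform_limit {-1..1} (\<lambda>a x. K_op q a c f x) f (at_right 0)"
proof -
  have c0: "c \<noteq> 0" and hc: "\<And>\<phi>. \<phi> \<in> {0..pi} \<Longrightarrow> hc c (cis \<phi>) \<noteq> 0"
    using c by (auto simp: admissible_iff)
  define E where "E = (\<lambda>(a, x). Kconst a c * hc (c * qpw (- a / 2)) (cis (arccos x)))"
  define G where "G = (\<lambda>x. f x / hc c (cis (arccos x)))"
  have arc: "arccos x \<in> {0..pi}" if "x \<in> {-1..1}" for x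
    using that by (auto simp: arccos_lbound arccos_ubound)
  have G: "continuous_on {-1..1} G"
    unfolding G_def using c0 hc[OF arc] by (intro continuous_intros f) auto
  \<comment> \<open>The exponential form shows continuity in \<open>a\<close> up to 0, where the
    constant is 1 because the base of the power is nonzero.\<close>
  have Kc: "Kconst a c = qpw (a * (a - 3) / 4) * exp (of_real a * Ln (of_real (1 - q) / (2 * c)))" for a
    using c0 q_less_1 by (simp add: Kconst_def powr_def)
  have E: "continuous_on ({0..1} \<times> {-1..1}) E"
    unfolding E_def case_prod_unfold Kc
    using c0 q_pos q_less_1 by (intro continuous_intros) auto
  have E0: "E (0, x) = hc c (cis (arccos x))" for x
    using c0 q_pos q_less_1 by (simp add: E_def Kconst_def)
  have "filterlim (\<lambda>a. q powr (a / 2)) (at_left 1) (at_right 0)"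
    unfolding filterlim_at
  proof
    have "((\<lambda>a. q powr (a / 2)) \<longlongrightarrow> q powr (0 / 2)) (at_right 0)"
      using q_pos by (intro tendsto_intros) auto
    thus "((\<lambda>a. q powr (a / 2)) \<longlongrightarrow> 1) (at_right 0)" using q_pos by simp
    show "\<forall>\<^sub>F a in at_right 0. q powr (a / 2) \<in> {..<1} \<and> q powr (a / 2) \<noteq> 1"
      using qpw_less_1 by (auto simp: eventually_at_filter intro!: always_eventually) (smt (verit) half_gt_zero)+
  qed
  hence 1: "uniform_limit {-1..1} (\<lambda>a x. integral {0..pi} (\<lambda>\<phi>. PK (qpw (a / 2)) (cis (arccos x)) \<phi> * G (cos \<phi>))) G (at_right 0)"
    by (rule filterlim_compose[OF PK_approximate_identity[OF G]])
  have 2: "uniform_limit {-1..1} (\<lambda>a x. E (a, x)) (\<lambda>x. E (0, x)) (at_right 0)"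
    using E by (rule uniform_limit_at_right_compact) auto
  have bE: "bounded ((\<lambda>x. E (0, x)) ` {-1..1})"
    by (intro compact_imp_bounded compact_continuous_image continuous_on_compose2[OF E] continuous_intros) auto
  have bG: "bounded (G ` {-1..1})"
    by (intro compact_imp_bounded compact_continuous_image G) auto
  have 3: "uniform_limit {-1..1} (\<lambda>a x. E (a, x) * integral {0..pi} (\<lambda>\<phi>. PK (qpw (a / 2)) (cis (arccos x)) \<phi> * G (cos \<phi>)))
          (\<lambda>x. E (0, x) * G x) (at_right 0)"
    by (rule uniform_lim_mult[OF 2 1 bE bG])
  have 4: "K_op q a c f x = E (a, x) * integral {0..pi} (\<lambda>\<phi>. PK (qpw (a / 2)) (cis (arccos x)) \<phi> * G (cos \<phi>))" for a x
  proof -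
    have "integral {0..pi} (\<lambda>\<phi>. PK (qpw (a / 2)) (cis (arccos x)) \<phi> * (f (cos \<phi>) / hc c (cis \<phi>))) = 
          integral {0..pi} (\<lambda>\<phi>. PK (qpw (a / 2)) (cis (arccos x)) \<phi> * G (cos \<phi>))"
      by (intro integral_cong) (auto simp: G_def arccos_cos)
    thus ?thesis unfolding K_op_def K_ext_eq E_def by simp
  qed
  have 5: "E (0, x) * G x = f x" if "x \<in> {-1..1}" for x
    using hc[OF arc[OF that]] by (simp add: E0 G_def)
  show ?thesis
    unfolding 4 by (rule iffD1[OF uniform_limit_cong' 3]) (simp_all only: 5)
qed

section \<open>The Askey--Wilson operator\<close>

text \<open>On this annulus all four arguments of \<open>qp\<close> in the denominator lie in the
  unit disc, where \<open>1 / qp\<close> is holomorphic. The integral can therefore be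
  differentiated under the integral sign.\<close>

lemma PK_integral_holomorphic:
  assumes r: "0 < r" "r < 1" and g: "continuous_on {0..pi} g"
  shows "(\<lambda>z. integral {0..pi} (\<lambda>\<phi>. PK (of_real r) z \<phi> * g \<phi>)) holomorphic_on {z. r < norm z \<and> norm z < 1 / r}"
proof -
  define A where "A = {z::complex. r < norm z \<and> norm z < 1 / r}"
  define p where "p = (\<lambda>x. 1 / qp x)"
  have p: "p holomorphic_on ball 0 1"
    unfolding p_def by (intro holomorphic_intros) (auto simp: qp_nonzero)
  have dp: "(p has_field_derivative deriv p x) (at x)" if "norm x < 1" for x
    using holomorphic_derivI[OF p open_ball] that by auto
  have cp: "continuous_on S (\<lambda>x. p (f x))" "continuous_on S (\<lambda>x. deriv p (f x))" 
    if "continuous_on S f" "\<And>x. x \<in> S \<Longrightarrow> norm (f x) < 1" for S and f :: "'b :: topological_space \<Rightarrow> complex"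
    using that
    by (auto intro!: continuous_on_compose2[OF holomorphic_on_imp_continuous_on[OF p]]
       continuous_on_compose2[OF holomorphic_on_imp_continuous_on[OF holomorphic_deriv[OF p open_ball]]])
  define R :: complex where "R = of_real r"
  define K where "K = (\<lambda>\<phi>. wt \<phi> * qp (R * R) * g \<phi>)"
  \<comment> \<open>The z-derivative by the product and chain rules, written out so that its joint
    continuity can be read off.\<close>
  define D where "D = (\<lambda>z \<phi>. K \<phi> * 
     (((deriv p (R * z * cis \<phi>) * (R * cis \<phi>)) * p (R * z / cis \<phi>) + (deriv p (R * z / cis \<phi>) * (R / cis \<phi>)) * p (R * z * cis \<phi>))
        * (p (R / z * cis \<phi>) * p (R / z / cis \<phi>)) + 
      ((deriv p (R / z * cis \<phi>) * (- R / z\<^sup>2 * cis \<phi>)) * p (R / z / cis \<phi>) + (deriv p (R / z / cis \<phi>) * (- R / z\<^sup>2 / cis \<phi>)) * p (R / z * cis \<phi>))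
        * (p (R * z * cis \<phi>) * p (R * z / cis \<phi>))))"
  have eq: "PK R z \<phi> * g \<phi> = K \<phi> * ((p (R * z * cis \<phi>) * p (R * z / cis \<phi>)) * (p (R / z * cis \<phi>) * p (R / z / cis \<phi>)))" for z \<phi>
    by (simp add: PK_def K_def p_def hh_def)
  have nrm: "norm (R * z * cis \<phi>) < 1" "norm (R * z / cis \<phi>) < 1" "norm (R / z * cis \<phi>) < 1" "norm (R / z / cis \<phi>) < 1" "z \<noteq> 0"
    if "z \<in> A" for z \<phi>
  proof -
    have z: "norm z > 0" "r * norm z < 1"
      using that r by (auto simp: A_def field_simps)
    moreover have "r / norm z < 1"
      using that z(1) by (subst divide_less_eq_1_pos) (auto simp: A_def)
    ultimately show "norm (R * z * cis \<phi>) < 1" "norm (R * z / cis \<phi>) < 1" "norm (R / z * cis \<phi>) < 1" "norm (R / z / cis \<phi>) < 1" "z \<noteq> 0"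
      using r by (auto simp: R_def norm_mult norm_divide)
  qed
  have K: "continuous_on {0..pi} K"
    unfolding K_def by (intro continuous_intros g)
  have deriv: "((\<lambda>z. PK R z \<phi> * g \<phi>) has_field_derivative D z \<phi>) (at z within U)" if "z \<in> A" for z \<phi> U
    unfolding eq D_def
    by (intro DERIV_cmult DERIV_mult DERIV_chain2[of p] dp nrm[OF that])
       (use nrm(5)[OF that] in \<open>auto intro!: derivative_eq_intros simp: power2_eq_square\<close>)
  have cont: "continuous_on (A \<times> {0..pi}) (\<lambda>(z, \<phi>). D z \<phi>)"
    unfolding D_def case_prod_unfold using nrm
    by (intro continuous_intros cp continuous_on_compose2[OF K]) auto
  have "(\<lambda>z. integral {0..pi} (\<lambda>\<phi>. PK R z \<phi> * g \<phi>)) field_differentiable (at z)" if z: "z \<in> A" for z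
  proof -
    \<comment> \<open>The Leibniz rule for holomorphic parameters is applied on a convex set; the
      annulus is not convex, but a small disc suffices.\<close>
    obtain e where e: "e > 0" "ball z e \<subseteq> A"
      using open_annulus z unfolding A_def by (meson openE)
    have "(\<lambda>z. integral (cbox 0 pi) (\<lambda>\<phi>. PK R z \<phi> * g \<phi>)) holomorphic_on ball z e"
    proof (rule leibniz_rule_holomorphic[where fx = D])
      show "((\<lambda>z. PK R z \<phi> * g \<phi>) has_field_derivative D x \<phi>) (at x within ball z e)" if "x \<in> ball z e" for x \<phi>
        using deriv e that by blast
      show "(\<lambda>\<phi>. PK R x \<phi> * g \<phi>) integrable_on cbox 0 pi" if "x \<in> ball z e" for x
        unfolding eq cbox_interval using nrm e that
        by (intro integrable_continuous_interval continuous_intros cp K) auto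
      show "continuous_on (ball z e \<times> cbox 0 pi) (\<lambda>(x, t). D x t)"
        by (rule continuous_on_subset[OF cont]) (use e in auto)
    qed auto
    thus ?thesis
      using e by (auto simp: holomorphic_on_def intro: at_within_open[of z "ball z e", THEN subst])
  qed
  thus ?thesis
    unfolding A_def[symmetric] R_def[symmetric] by (simp add: holomorphic_on_def field_differentiable_at_within)
qed

section \<open>Symmetry and analytic extension of the operator's values\<close>

lemma hc_inverse: "hc c (1 / z) = hc c z"
  by (simp add: hc_def hh_inverse)

lemma K_ext_inverse: "K_ext q a c f (1 / z) = K_ext q a c f z"
proof -
  have "PK r (1 / z) \<phi> = PK r z \<phi>" for r \<phi>
    by (simp add: PK_def mult.commute)
  thus ?thesis by (simp add: K_ext_eq hc_inverse)
qed

lemma K_ext_holomorphic: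
  assumes a: "a > 0" and c: "admissible q c" and f: "continuous_on {-1..1} f"
  shows "K_ext q a c f holomorphic_on {z. q powr (a / 2) < norm z \<and> norm z < 1 / q powr (a / 2)}"
proof -
  have "z \<noteq> 0" if "q powr (a / 2) < norm z" for z :: complex
    using that qpw_pos[of "a / 2"] by auto
  hence "(\<lambda>z. Kconst a c * hc (c * qpw (- a / 2)) z) holomorphic_on {z. q powr (a / 2) < norm z \<and> norm z < 1 / q powr (a / 2)}"
    unfolding hc_def by (intro holomorphic_intros) auto
  moreover have "(\<lambda>z. integral {0..pi} (\<lambda>\<phi>. PK (qpw (a / 2)) z \<phi> * (f (cos \<phi>) / hc c (cis \<phi>))))
      holomorphic_on {z. q powr (a / 2) < norm z \<and> norm z < 1 / q powr (a / 2)}"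
    using a qpw_pos qpw_less_1[of "a / 2"] quotient_continuous[OF c f]
    by (intro PK_integral_holomorphic) auto
  ultimately show ?thesis
    unfolding K_ext_eq[abs_def] by (rule holomorphic_on_mult)
qed

lemma K_op_continuous:
  assumes a: "a > 0" and c: "admissible q c" and f: "continuous_on {-1..1} f"
  shows "continuous_on {-1..1} (K_op q a c f)"
  unfolding K_op_def[abs_def]
proof (rule continuous_on_compose2[OF holomorphic_on_imp_continuous_on[OF K_ext_holomorphic[OF assms]]])
  show "continuous_on {-1..1} (\<lambda>x. cis (arccos x))" by (intro continuous_intros) auto
  show "(\<lambda>x. cis (arccos x)) ` {-1..1} \<subseteq> {z. q powr (a / 2) < cmod z \<and> cmod z < 1 / q powr (a / 2)}"
    using qpw_less_1[of "a / 2"] qpw_pos[of "a / 2"] a by auto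
qed

text \<open>The condition \<open>a > 1\<close> places \<open>q powr (a / 2)\<close> below
  \<open>sqrt q\<close>, so the annulus of holomorphy is large enough.\<close>

lemma K_ext_is_breve:
  assumes a: "a > 1" and c: "admissible q c" and f: "continuous_on {-1..1} f"
  shows "is_breve q (K_op q a c f) (K_ext q a c f)"
  unfolding is_breve_def
proof (intro conjI exI allI)
  show "0 < q powr (a / 2)" by (rule qpw_pos)
  show "q powr (a / 2) < sqrt q"
    using a q_pos q_less_1 by (simp add: powr_half_sqrt[symmetric] powr_less_mono')
  show "K_ext q a c f holomorphic_on {z. q powr (a / 2) < norm z \<and> norm z < 1 / q powr (a / 2)}"
    using a by (intro K_ext_holomorphic c f) auto
  fix \<theta> :: real
  \<comment> \<open>For arbitrary real \<theta> the point used by \<open>K_op\<close> is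
    \<open>cis \<theta>\<close> or its inverse; the symmetry of \<open>K_ext\<close> under inversion
    makes the values agree.\<close>
  define \<psi> where "\<psi> = arccos (cos \<theta>)"
  have cos: "cos \<psi> = cos \<theta>" by (simp add: \<psi>_def)
  hence "(sin \<psi>)\<^sup>2 = (sin \<theta>)\<^sup>2" by (simp add: sin_squared_eq)
  hence "sin \<psi> = sin \<theta> \<or> sin \<psi> = - sin \<theta>" by (simp add: power2_eq_iff)
  hence "cis \<psi> = cis \<theta> \<or> cis \<psi> = 1 / cis \<theta>"
    unfolding cis_minus[symmetric] using cos by (auto simp: complex_eq_iff)
  thus "K_ext q a c f (cis \<theta>) = K_op q a c f (cos \<theta>)"
    unfolding K_op_def \<psi>_def[symmetric] using K_ext_inverse by metis
qed

text \<open>With the theta function (x, q/x; q), \<open>hc c z\<close> is its product at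
  \<open>x = - z / c\<close> and \<open>x = - 1 / (c * z)\<close>, and this is quasi-periodicity.
  The two sides share the factor \<open>T\<close> and differ only in the leading factors
  \<open>1 + c * s / z\<close> and \<open>1 + z / (c * s)\<close>.\<close>

lemma hc_half_shift:
  assumes "c \<noteq> 0" "z \<noteq> 0"
  shows "hc c (s * z) = s * c / z * hc (c * s) z"
proof -
  have s0: "s \<noteq> 0" and ss: "of_real q = s * s" using sqrt_q by auto
  define T where "T = qp (- (of_real q * (z / (c * s)))) * qp (- (1 / (c * s * z))) * qp (- (c * s * of_real q * z)) * qp (- (c * s * of_real q / z))"
  have "hc c (s * z) = qp (- (of_real q * (z / (c * s)))) * qp (- (1 / (c * s * z))) * qp (- (c * s * of_real q * z)) * qp (- (c * s / z))"
    using assms s0 unfolding hc_def hh_def ss by (simp add: mult_ac)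
  also have "qp (- (c * s / z)) = (1 + c * s / z) * qp (- (c * s * of_real q / z))"
    by (subst qp_rec) (simp add: mult_ac)
  finally have 1: "hc c (s * z) = (1 + c * s / z) * T" by (simp add: T_def mult_ac)
  have "hc (c * s) z = qp (- (z / (c * s))) * qp (- (1 / (c * s * z))) * qp (- (c * s * of_real q * z)) * qp (- (c * s * of_real q / z))"
    unfolding hc_def hh_def by (simp add: mult_ac)
  also have "qp (- (z / (c * s))) = (1 + z / (c * s)) * qp (- (of_real q * (z / (c * s))))"
    by (subst qp_rec) (simp add: mult_ac)
  finally have 2: "hc (c * s) z = (1 + z / (c * s)) * T" by (simp add: T_def mult_ac)
  have "1 + c * s / z = s * c / z * (1 + z / (c * s))"
    using assms s0 by (simp add: field_simps)
  thus ?thesis unfolding 1 2 by (simp only: mult.assoc)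
qed

text \<open>The shifted parameters are \<open>q * v * z\<close> and \<open>v / z\<close>. Lowering
  the first to \<open>v * z\<close> costs two linear factors, whose product is affine in
  \<open>cis \<phi> + 1 / cis \<phi>\<close>.\<close>

lemma PK_half_shift:
  assumes r: "r = v * s" and v: "norm v < 1" and z: "norm z = 1"
  shows "PK r (s * z) \<phi> = qp (r * r) * (wt \<phi> / (hh (v * z) (cis \<phi>) * hh (v / z) (cis \<phi>)))
     * (1 + v\<^sup>2 * z\<^sup>2 - v * z * (cis \<phi> + 1 / cis \<phi>))"
proof -
  define w where "w = cis \<phi>"
  have w: "w * (1 / w) = 1" by (simp add: w_def)
  have s0: "s \<noteq> 0" and ss: "of_real q = s * s" using sqrt_q by auto
  have *: "r * (s * z) = of_real q * (v * z)" "r / (s * z) = v / z"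
    using s0 by (simp_all add: r ss)
  have "hh (v * z) w \<noteq> 0"
    unfolding w_def using v z by (intro hh_cis_nonzero) (simp add: norm_mult)
  hence nz: "(1 - v * z * w) * (1 - v * z / w) \<noteq> 0"
    using hh_q[of "v * z" w] by auto
  have "(1 - v * z * w) * (1 - v * z / w) = 1 + v\<^sup>2 * z\<^sup>2 * (w * (1 / w)) - v * z * (w + 1 / w)"
    by (simp add: algebra_simps power2_eq_square)
  hence eq: "1 + v\<^sup>2 * z\<^sup>2 - v * z * (w + 1 / w) = (1 - v * z * w) * (1 - v * z / w)"
    unfolding w by simp
  show ?thesis
    unfolding PK_def * w_def[symmetric] eq hh_q[of "v * z" w, symmetric] using nz by (auto simp: w_def)
qed

section \<open>The divided difference of the extended operator\<close>

lemma s_eq_qpw: "s = qpw (1 / 2)"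
  using q_pos by (simp add: powr_half_sqrt)

text \<open>The factor \<open>c\<close> absorbs one power of \<open>(1 - q) / (2 * c)\<close>, and
  the exponents of q add up to those of order \<open>a - 1\<close>. The leftover
  \<open>(1 - q) / 2\<close> will cancel against the denominator of the divided difference.\<close>

lemma Kconst_step:
  assumes "c \<noteq> 0"
  shows "s * (Kconst a c * (c * qpw (- (a - 1) / 2))) = of_real ((1 - q) / 2) * Kconst (a - 1) c"
proof -
  define w where "w = of_real (1 - q) / (2 * c)"
  have w0: "w \<noteq> 0" using assms q_less_1 by (simp add: w_def)
  have "w powr of_real a = w powr (of_real (a - 1) + 1)" by simp
  also have "\<dots> = w powr of_real (a - 1) * w"
    by (subst powr_add) (use w0 in simp)
  finally have wa: "w powr of_real a = w powr of_real (a - 1) * w" .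
  have wc: "w * c = of_real ((1 - q) / 2)" using assms by (simp add: w_def)
  have "1 / 2 + a * (a - 3) / 4 + (- (a - 1) / 2) = (a - 1) * (a - 1 - 3) / 4"
    by (simp add: field_simps)
  hence qq: "s * qpw (a * (a - 3) / 4) * qpw (- (a - 1) / 2) = qpw ((a - 1) * (a - 1 - 3) / 4)"
    unfolding s_eq_qpw qpw_add[symmetric] by (simp only:)
  have "s * (Kconst a c * (c * qpw (- (a - 1) / 2))) = 
     (s * qpw (a * (a - 3) / 4) * qpw (- (a - 1) / 2)) * w powr of_real (a - 1) * (w * c)"
    unfolding Kconst_def w_def[symmetric] wa by (simp only: mult_ac)
  also have "\<dots> = of_real ((1 - q) / 2) * Kconst (a - 1) c"
    unfolding qq wc Kconst_def w_def[symmetric] by (simp only: mult_ac)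
  finally show ?thesis .
qed

text \<open>The values at both shifted points are combinations of the same two moments
  \<open>J0\<close> and \<open>J1\<close>. Their difference retains only \<open>J0\<close>, which is
  the Poisson integral of radius \<open>v\<close> up to a constant.\<close>

lemma AW_quotient_K_ext:
  assumes a: "a > 1" and c: "admissible q c" and f: "continuous_on {-1..1} f"
    and z: "norm z = 1" "z\<^sup>2 \<noteq> 1"
  shows "AW_quotient q (K_ext q a c f) z = K_ext q (a - 1) c f z"
proof -
  define v where "v = qpw ((a - 1) / 2)"
  define r where "r = qpw (a / 2)"
  define c1 where "c1 = c * qpw (- a / 2)"
  define c0 where "c0 = c * qpw (- (a - 1) / 2)"
  define g where "g = (\<lambda>\<phi>. f (cos \<phi>) / hc c (cis \<phi>))"
  have K_g: "K_ext q b c f y = Kconst b c * hc (c * qpw (- b / 2)) y * integral {0..pi} (\<lambda>\<phi>. PK (qpw (b / 2)) y \<phi> * g \<phi>)" for b y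
    unfolding g_def by (rule K_ext_eq)
  have c_nz: "c \<noteq> 0" "c1 \<noteq> 0" using c qpw_nonzero by (simp_all add: admissible_iff c1_def del: of_real_eq_0_iff powr_eq_0_iff)
  have s0: "s \<noteq> 0" and ss: "s * s = of_real q" using sqrt_q by auto
  have g: "continuous_on {0..pi} g" unfolding g_def by (rule quotient_continuous[OF c f])
  have v: "norm v < 1" unfolding v_def norm_qpw using a by (intro qpw_less_1) auto
  have "a / 2 = (a - 1) / 2 + 1 / 2" by (simp add: field_simps)
  hence r: "r = v * s" unfolding r_def v_def s_eq_qpw qpw_add[symmetric] by (simp only:)
  have "- (a - 1) / 2 = - a / 2 + 1 / 2" by (simp add: field_simps)
  hence c0: "c0 = c1 * s" unfolding c0_def c1_def s_eq_qpw by (simp only: qpw_add mult.assoc)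
  define Q where "Q = (\<lambda>\<phi>. wt \<phi> / (hh (v * z) (cis \<phi>) * hh (v / z) (cis \<phi>)) * g \<phi>)"
  define J0 where "J0 = integral {0..pi} Q"
  define J1 where "J1 = integral {0..pi} (\<lambda>\<phi>. (cis \<phi> + 1 / cis \<phi>) * Q \<phi>)"
  define C where "C = Kconst a c * c0 * hc c0 z * qp (r * r)"
  have z0: "z \<noteq> 0" using z by auto
  have Q: "continuous_on {0..pi} Q"
    unfolding Q_def using v z by (intro continuous_intros g) (auto simp: norm_mult norm_divide)
  \<comment> \<open>The case \<open>y = 1 / z\<close> serves the point \<open>z / s\<close>, which
    is the inverse of \<open>s * (1 / z)\<close>; \<open>Q\<close> and \<open>hc c0\<close> do not
    change under this inversion.\<close>
  have half: "K_ext q a c f (s * y) = C / y * ((1 + v\<^sup>2 * y\<^sup>2) * J0 - v * y * J1)"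
    if y: "y = z \<or> y = 1 / z" for y
  proof -
    have y1: "norm y = 1" "y \<noteq> 0" using y z by (auto simp: norm_divide)
    have "hc c0 y = hc c0 z" using y by (auto simp: hc_inverse)
    hence hc: "hc c1 (s * y) = c0 / y * hc c0 z"
      using hc_half_shift[of c1 y] c_nz y1 by (simp add: c0 mult.commute)
    have Q_eq: "wt \<phi> / (hh (v * y) (cis \<phi>) * hh (v / y) (cis \<phi>)) * g \<phi> = Q \<phi>" for \<phi>
      using y by (auto simp: Q_def mult.commute)
    have "PK r (s * y) \<phi> * g \<phi> = qp (r * r) * ((1 + v\<^sup>2 * y\<^sup>2) * Q \<phi> - v * y * ((cis \<phi> + 1 / cis \<phi>) * Q \<phi>))" for \<phi>
    proof -
      have "PK r (s * y) \<phi> * g \<phi> = qp (r * r) * Q \<phi> * (1 + v\<^sup>2 * y\<^sup>2 - v * y * (cis \<phi> + 1 / cis \<phi>))"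
        unfolding PK_half_shift[OF r v y1(1)] Q_eq[symmetric] by (simp only: mult_ac)
      thus ?thesis by (simp add: algebra_simps)
    qed
    hence "integral {0..pi} (\<lambda>\<phi>. PK r (s * y) \<phi> * g \<phi>) = 
       qp (r * r) * integral {0..pi} (\<lambda>\<phi>. (1 + v\<^sup>2 * y\<^sup>2) * Q \<phi> - v * y * ((cis \<phi> + 1 / cis \<phi>) * Q \<phi>))"
      by (simp only: integral_mult_right)
    also have "integral {0..pi} (\<lambda>\<phi>. (1 + v\<^sup>2 * y\<^sup>2) * Q \<phi> - v * y * ((cis \<phi> + 1 / cis \<phi>) * Q \<phi>)) = 
       (1 + v\<^sup>2 * y\<^sup>2) * J0 - v * y * J1"
      unfolding J0_def J1_def integral_mult_right[symmetric]
      by (intro integral_diff integrable_continuous_interval continuous_intros Q) auto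
    finally show ?thesis
      unfolding K_g r_def[symmetric] c1_def[symmetric] hc C_def by simp
  qed
  have "K_ext q a c f (z / s) = K_ext q a c f (s * (1 / z))"
    using K_ext_inverse[of a c f "s * (1 / z)"] by simp
  also have "\<dots> = C * z * ((1 + v\<^sup>2 / z\<^sup>2) * J0 - v / z * J1)"
    using half[of "1 / z"] by (simp add: power_divide)
  finally have "K_ext q a c f (s * z) - K_ext q a c f (z / s) = 
     C / z * ((1 + v\<^sup>2 * z\<^sup>2) * J0 - v * z * J1) - C * z * ((1 + v\<^sup>2 / z\<^sup>2) * J0 - v / z * J1)"
    using half[of z] by simp
  \<comment> \<open>The term in \<open>J1\<close> is \<open>C * v * J1\<close> at both points and
    cancels.\<close>
  also have "\<dots> = - (C * J0 * (1 - v * v) * (z - 1 / z))"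
    using z0 by (simp add: field_simps power2_eq_square)
  finally have diff: "K_ext q a c f (s * z) - K_ext q a c f (z / s) = - (C * J0 * (1 - v * v) * (z - 1 / z))" .
  \<comment> \<open>Since \<open>r * r = q * v * v\<close>, the factor \<open>1 - v * v\<close> from
    the difference completes the numerator of the kernel of radius \<open>v\<close>.\<close>
  have "qp (v * v) = (1 - v * v) * qp (r * r)"
    by (subst qp_rec) (simp add: r ss[symmetric] mult_ac)
  moreover have "integral {0..pi} (\<lambda>\<phi>. PK v z \<phi> * g \<phi>) = qp (v * v) * J0"
  proof -
    have "PK v z \<phi> * g \<phi> = qp (v * v) * Q \<phi>" for \<phi> by (simp add: PK_def Q_def)
    thus ?thesis unfolding J0_def by (simp only: integral_mult_right)
  qed
  ultimately have K1: "K_ext q (a - 1) c f z = Kconst (a - 1) c * hc c0 z * ((1 - v * v) * qp (r * r) * J0)"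
    unfolding K_g[of "a - 1"] v_def[symmetric] c0_def[symmetric] by (simp only: mult.assoc)
  have "s * (C * J0 * (1 - v * v)) = (s * (Kconst a c * c0)) * (hc c0 z * ((1 - v * v) * qp (r * r) * J0))"
    unfolding C_def by (simp only: mult_ac)
  also have "\<dots> = of_real ((1 - q) / 2) * K_ext q (a - 1) c f z"
    unfolding K1 c0_def Kconst_step[OF c_nz(1)] by (simp only: mult_ac)
  finally have fin: "C * J0 * (1 - v * v) = of_real ((1 - q) / 2) * K_ext q (a - 1) c f z / s"
    using s0 by (simp add: field_simps)
  have zz: "z - 1 / z \<noteq> 0" using z z0 by (simp add: field_simps power2_eq_square)
  have "of_real (sqrt q - 1 / sqrt q) = - (of_real (1 - q) / s)"
    using s0 q_pos by (simp add: field_simps ss)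
  moreover have "of_real (1 - q) \<noteq> (0 :: complex)" using q_less_1 by simp
  ultimately show ?thesis
    unfolding AW_quotient_def diff fin using zz s0
    by (simp add: divide_simps) (simp add: algebra_simps)
qed

theorem AW_op_K_op:
  assumes a: "a > 1" and c: "admissible q c" and f: "continuous_on {-1..1} f" and x: "x \<in> {-1..1}"
  shows "AW_op q (K_op q a c f) x = K_op q (a - 1) c f x"
proof -
  define F where "F = breve q (K_op q a c f)"
  have "is_breve q (K_op q a c f) F"
    unfolding F_def breve_def by (rule someI[of "is_breve q (K_op q a c f)", OF K_ext_is_breve[OF a c f]])
  \<comment> \<open>The quotient evaluates the extension only on the two boundary circles of this
    closed annulus, where it is independent of the choice.\<close>
  hence F: "F z = K_ext q a c f z" if "sqrt q \<le> norm z" "norm z \<le> 1 / sqrt q" for z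
    using is_breve_unique[OF _ K_ext_is_breve[OF a c f] q_pos q_less_1 that] by blast
  have quot: "AW_quotient q F (cis (arccos y)) = K_op q (a - 1) c f y" if y: "y \<in> {-1<..<1}" for y
  proof -
    have "sin (arccos y) \<noteq> 0" using y sin_arccos_nonzero[of y] by auto
    hence "(cis (arccos y))\<^sup>2 \<noteq> 1"
      using y by (auto simp: complex_eq_iff power2_eq_square) 
    hence "AW_quotient q (K_ext q a c f) (cis (arccos y)) = K_op q (a - 1) c f y"
      unfolding K_op_def by (intro AW_quotient_K_ext a c f) auto
    moreover have "sqrt q \<le> 1 / sqrt q" using sqrt_q q_pos q_less_1 by (simp add: field_simps)
    ultimately show ?thesis
      using sqrt_q q_pos unfolding AW_quotient_def by (simp add: F norm_mult norm_divide)
  qed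
  show ?thesis
  proof (cases "x \<in> {-1<..<1}")
    case True
    thus ?thesis using quot by (simp add: AW_op_def F_def)
  next
    case False
    \<comment> \<open>An endpoint is a limit point of the open interval, so the limit in
      \<open>AW_op\<close> is determined; continuity of the operator of order \<open>a - 1\<close>
      gives its value.\<close>
    have "x islimpt {-1<..<1}"
      using False x by (auto simp: islimpt_greaterThanLessThan1 islimpt_greaterThanLessThan2)
    hence nt: "at x within {-1<..<1} \<noteq> bot" by (simp add: trivial_limit_within)
    have "(K_op q (a - 1) c f \<longlongrightarrow> K_op q (a - 1) c f x) (at x within {-1..1})"
      using K_op_continuous[of "a - 1" c f] a c f x by (auto simp: continuous_on_def)
    hence "(K_op q (a - 1) c f \<longlongrightarrow> K_op q (a - 1) c f x) (at x within {-1<..<1})"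
      by (rule tendsto_within_subset) auto
    moreover have "\<forall>\<^sub>F y in at x within {-1<..<1}. K_op q (a - 1) c f y = AW_quotient q F (cis (arccos y))"
      using quot by (auto simp: eventually_at_filter)
    ultimately have "((\<lambda>y. AW_quotient q F (cis (arccos y))) \<longlongrightarrow> K_op q (a - 1) c f x) (at x within {-1<..<1})"
      by (rule Lim_transform_eventually)
    hence "Lim (at x within {-1<..<1}) (\<lambda>y. AW_quotient q F (cis (arccos y))) = K_op q (a - 1) c f x"
      by (rule tendsto_Lim[OF nt])
    thus ?thesis using False unfolding AW_op_def F_def by (simp only: if_False)
  qed
qed

end

theorem theorem3p1:
  fixes q :: real
  assumes "0 < q" and "q < 1"
  shows
    "(\<forall>(a::real) (b::real) (c::complex) (f::real \<Rightarrow> complex).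
        a > 0 \<longrightarrow> b > 0 \<longrightarrow> admissible q c \<longrightarrow> admissible q (c * of_real (q powr (- a / 2))) \<longrightarrow>
        continuous_on {-1..1} f \<longrightarrow>
        (\<forall>x\<in>{-1..1}. K_op q b (c * of_real (q powr (- a / 2))) (K_op q a c f) x
                      = K_op q (a + b) c f x))
     \<and>
     (\<forall>(c::complex) (f::real \<Rightarrow> complex).
        admissible q c \<longrightarrow> continuous_on {-1..1} f \<longrightarrow>
        uniform_limit {-1..1} (\<lambda>a x. K_op q a c f x) f (at_right 0))
     \<and>
     (\<forall>(a::real) (c::complex) (f::real \<Rightarrow> complex).
        a > 1 \<longrightarrow> admissible q c \<longrightarrow> continuous_on {-1..1} f \<longrightarrow>
        is_breve q (K_op q a c f) (K_ext q a c f) \<and>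
        (\<forall>x\<in>{-1..1}. AW_op q (K_op q a c f) x = K_op q (a - 1) c f x))"
proof -
  interpret q_base q by unfold_locales (use assms in auto)
  show ?thesis
    by (intro conjI allI impI ballI K_op_semigroup K_op_tendsto_identity K_ext_is_breve AW_op_K_op; assumption)
qed

end
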